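(* Let $\alpha,t_0\in\mathbb{R}$, let $\rho_0,c_0,\rho_1,c_1,K,d>0$, and let $p\geq 1$ be an integer. Let $\boldsymbol{U}_0:\mathbb{R}\to\mathbb{R}^2$ be a function of class $C^p_c(\mathbb{R})$ ($C^p$ with compact support), with support included in $\Omega_0=(-\infty,\alpha)$. Then there exists a unique global solution $\boldsymbol{U}=(v,\sigma)^T$, of class $C^p$ on $(\mathbb{R}\setminus\{\alpha\})\times[t_0,+\infty)$, to the initial-boundary value problem $$ \left\{ \begin{array}{l} \dfrac{\partial \boldsymbol{U}}{\partial t}(x,t)+\boldsymbol{A}(x)\,\dfrac{\partial \boldsymbol{U}}{\partial x}(x,t)=\boldsymbol{0}\quad\text{for } x\in\mathbb{R},\ x\neq\alpha,\ t\geq t_0,\\[8pt] v(\alpha^+,t)=v(\alpha^-,t)+\dfrac{\rho_0c_0^2}{K}\,\dfrac{1}{\left(1-\frac{\sigma(\alpha^-,t)}{Kd}\right)^2}\,\dfrac{\partial v}{\partial x}(\alpha^-,t),\qquad \sigma(\alpha^+,t)=\sigma(\alpha^-,t)\quad\text{for } t\geq t_0,\\[8pt] \boldsymbol{U}(x,t_0)=\boldsymbol{U}_0(x)\quad\text{for } x\in\mathbb{R}. \end{array} \right. $$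
   Context: $\Omega_0=(-\infty,\alpha)$ and $\Omega_1=(\alpha,+\infty)$ are two linearly elastic media. The density $\rho$ and the wave speed $c$ are piecewise constant: $(\rho,c)=(\rho_0,c_0)$ on $\Omega_0$ and $(\rho,c)=(\rho_1,c_1)$ on $\Omega_1$, all positive. $K>0$ is the stiffness and $d>0$ the maximum allowable closure of the fracture located at $\alpha$. The unknown is $\boldsymbol{U}=(v,\sigma)^T$ (elastic velocity and stress), and $$\boldsymbol{A}(x)=\begin{pmatrix}0&-\frac1\rho\\ -\rho c^2&0\end{pmatrix},$$ so the system reads $\rho\,\partial_t v=\partial_x\sigma$, $\partial_t\sigma=\rho c^2\,\partial_x v$ on each side of $\alpha$. For a function $w$, $w(\alpha^\pm,t)$ denotes its limit at $\alpha$ from the right ($+$) or from the left ($-$). A solution is understood in the classical sense: $\boldsymbol{U}$ is $C^1$ on $\Omega_0\times[t_0,+\infty)$ and on $\Omega_1\times[t_0,+\infty)$, and on each side $\boldsymbol{U}$ and its first-order derivatives extend continuously up to $x=\alpha$. The solution is moreover required to satisfy $\sigma(\alpha^-,t)<Kd$ for all $t\geq t_0$ (the physical branch of the hyperbolic jump law). "Global" means defined for all $t\ge t_0$. *)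

theory Defs
  imports "HOL-Analysis.Analysis"
begin

text \<open>
  Class \<open>C\<^sup>k\<close> on a set. Derivatives are taken within \<open>S\<close>, so on half-spaces such as
  \<open>{..<a} \<times> {t0..}\<close> they are one-sided at the boundary points that belong to \<open>S\<close>. The notion
  is meant for sets on which the derivative within \<open>S\<close> is unique (open sets, convex sets with
  nonempty interior, unions of such relatively open pieces). Continuity of \<open>\<lambda>z. f' z h\<close> for
  every fixed \<open>h\<close> amounts to continuity of \<open>f'\<close> because the domain is finite-dimensional.
\<close>

primrec Ck_on ::
  "nat \<Rightarrow> 'a::euclidean_space set \<Rightarrow> ('a \<Rightarrow> 'b::real_normed_vector) \<Rightarrow> bool" where
  "Ck_on 0 S f \<longleftrightarrow> continuous_on S f"
| "Ck_on (Suc k) S f \<longleftrightarrow>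
     (\<exists>f'. (\<forall>z\<in>S. (f has_derivative f' z) (at z within S)) \<and> (\<forall>h. Ck_on k S (\<lambda>z. f' z h)))"

definition supp :: "('a::topological_space \<Rightarrow> 'b::zero) \<Rightarrow> 'a set" where
  "supp f = closure {x. f x \<noteq> 0}"

definition piecewise_const :: "real \<Rightarrow> real \<Rightarrow> real \<Rightarrow> real \<Rightarrow> real" where
  "piecewise_const \<alpha> a0 a1 x = (if x < \<alpha> then a0 else a1)"

definition coeff_matrix :: "real \<Rightarrow> real \<Rightarrow> real^2^2" where
  "coeff_matrix \<rho> c = vector [vector [0, - (1 / \<rho>)], vector [- (\<rho> * c\<^sup>2), 0]]"

text \<open>Functions of space and time take the pair \<open>(x, t)\<close>; times are \<open>t \<ge> t0\<close>, so the time
  derivative at \<open>t0\<close> is the right derivative.\<close>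

definition partial_x :: "(real \<times> real \<Rightarrow> 'b::real_normed_vector) \<Rightarrow> real \<times> real \<Rightarrow> 'b" where
  "partial_x w = (\<lambda>(x, t). vector_derivative (\<lambda>y. w (y, t)) (at x))"

definition partial_t ::
  "real \<Rightarrow> (real \<times> real \<Rightarrow> 'b::real_normed_vector) \<Rightarrow> real \<times> real \<Rightarrow> 'b" where
  "partial_t t0 w = (\<lambda>(x, t). vector_derivative (\<lambda>s. w (x, s)) (at t within {t0..}))"

text \<open>The traces \<open>w(\<alpha>\<^sup>-, t)\<close> and \<open>w(\<alpha>\<^sup>+, t)\<close>. They are only used for functions
  for which \<open>classical_regular\<close> below guarantees that the limits exist.\<close>

definition trace_left :: "real \<Rightarrow> (real \<times> real \<Rightarrow> 'b::t2_space) \<Rightarrow> real \<Rightarrow> 'b" where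
  "trace_left \<alpha> w t = Lim (at_left \<alpha>) (\<lambda>x. w (x, t))"

definition trace_right :: "real \<Rightarrow> (real \<times> real \<Rightarrow> 'b::t2_space) \<Rightarrow> real \<Rightarrow> 'b" where
  "trace_right \<alpha> w t = Lim (at_right \<alpha>) (\<lambda>x. w (x, t))"

definition extends_continuously ::
  "'a::topological_space set \<Rightarrow> 'a set \<Rightarrow> ('a \<Rightarrow> 'b::topological_space) \<Rightarrow> bool" where
  "extends_continuously S T w \<longleftrightarrow> (\<exists>W. continuous_on T W \<and> (\<forall>z\<in>S. W z = w z))"

definition classical_regular ::
  "real \<Rightarrow> real \<Rightarrow> (real \<times> real \<Rightarrow> 'b::real_normed_vector) \<Rightarrow> bool" where
  "classical_regular \<alpha> t0 U \<longleftrightarrow>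
     Ck_on 1 ({..<\<alpha>} \<times> {t0..}) U \<and>
     Ck_on 1 ({\<alpha><..} \<times> {t0..}) U \<and>
     (\<forall>w\<in>{U, partial_x U, partial_t t0 U}.
        extends_continuously ({..<\<alpha>} \<times> {t0..}) ({..\<alpha>} \<times> {t0..}) w \<and>
        extends_continuously ({\<alpha><..} \<times> {t0..}) ({\<alpha>..} \<times> {t0..}) w)"

text \<open>Component 1 of \<open>U\<close> is the velocity \<open>v\<close>, component 2 the stress \<open>\<sigma>\<close>. The values
  \<open>U (\<alpha>, t)\<close> are irrelevant, except that the initial condition fixes \<open>U (\<alpha>, t0)\<close>.\<close>

definition global_solution ::
  "real \<Rightarrow> real \<Rightarrow> real \<Rightarrow> real \<Rightarrow> real \<Rightarrow> real \<Rightarrow> real \<Rightarrow> real \<Rightarrow>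
   (real \<Rightarrow> real^2) \<Rightarrow> (real \<times> real \<Rightarrow> real^2) \<Rightarrow> bool" where
  "global_solution \<alpha> t0 \<rho>0 c0 \<rho>1 c1 K d U0 U \<longleftrightarrow>
     (let \<rho> = piecewise_const \<alpha> \<rho>0 \<rho>1;
          c = piecewise_const \<alpha> c0 c1;
          A = (\<lambda>x. coeff_matrix (\<rho> x) (c x));
          v = (\<lambda>z. U z $ 1);
          \<sigma> = (\<lambda>z. U z $ 2)
      in classical_regular \<alpha> t0 U \<and>
         (\<forall>t\<ge>t0. trace_left \<alpha> \<sigma> t < K * d) \<and>
         (\<forall>x t. x \<noteq> \<alpha> \<longrightarrow> t \<ge> t0 \<longrightarrow> partial_t t0 U (x, t) + A x *v partial_x U (x, t) = 0) \<and>
         (\<forall>t\<ge>t0.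
            trace_right \<alpha> v t =
              trace_left \<alpha> v t
              + \<rho>0 * c0\<^sup>2 / K * (1 / (1 - trace_left \<alpha> \<sigma> t / (K * d))\<^sup>2)
                * trace_left \<alpha> (partial_x v) t \<and>
            trace_right \<alpha> \<sigma> t = trace_left \<alpha> \<sigma> t) \<and>
         (\<forall>x. U (x, t0) = U0 x))"

end

theory Submission
  imports Defs
begin

text \<open>
  On either side of the fracture the system has constant coefficients, so a solution is a sum of a
  right-going and a left-going wave: the two Riemann invariants are transported along
  characteristics (lemmas \<open>riemann_constant_on_characteristic\<close> and
  \<open>riemann_decomposition\<close>). Nothing enters \<open>\<Omega>\<^sub>1\<close> from the right, since the data
  vanish there; on \<open>\<Omega>\<^sub>0\<close> the right-going wave is given by the data. Everything else is
  determined by one unknown, the stress \<open>s(t)\<close> at the fracture. With the impedances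
  \<open>Z\<^sub>i = \<rho>\<^sub>i c\<^sub>i\<close> and the incident amplitude \<open>q(t)\<close>, the traces of the
  velocity are \<open>q + s / Z\<^sub>0\<close> on the left and \<open>- s / Z\<^sub>1\<close> on the right. Since
  \<open>\<rho>\<^sub>0 c\<^sub>0\<^sup>2 \<partial>v/\<partial>x = \<partial>\<sigma>/\<partial>t\<close> up to the
  interface, the jump law becomes the scalar equation
  \<open>s' = K (1 - s/(K d))\<^sup>2 (- q - \<beta> s)\<close> with \<open>\<beta> = 1/Z\<^sub>0 + 1/Z\<^sub>1\<close> and
  \<open>s(t\<^sub>0) = 0\<close>.

  This equation has a global solution in \<open>s < K d\<close>: the constant \<open>K d\<close> solves it, so it cannot
  be reached, and where \<open>s < - \<bar>q\<bar>/\<beta>\<close> the right-hand side is nonnegative, so \<open>s\<close> stays bounded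
  below, since \<open>q\<close> is bounded. Truncating the right-hand side to the resulting bounded range makes
  it Lipschitz, and the contraction principle applies (lemma \<open>stress_ode_solution\<close>). Differences of two solutions obey a
  linear equation, which gives uniqueness (lemma \<open>stress_ode_unique\<close>).

  Conversely, the waves built from such a stress solve the problem
  (lemma \<open>solution_is_global_solution\<close>), and every solution has these waves
  (lemma \<open>solution_unique\<close>). The regularity needs no matching along the characteristics
  that leave the corner \<open>(\<alpha>, t\<^sub>0)\<close>: the data vanish for \<open>x \<ge> \<alpha>\<close> and the
  stress, extended by zero, solves its equation for all times, so the reflected wave can be
  superposed on the initial one and all amplitudes are \<open>C\<^sup>p\<close> on the whole line.
\<close>

section \<open>Functions of class \<open>C\<^sup>k\<close>\<close>

lemma Ck_on_cong:
  assumes "\<And>z. z \<in> S \<Longrightarrow> f z = g z" and "Ck_on k S f"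
  shows "Ck_on k S g"
proof (cases k)
  case 0
  then show ?thesis using assms by (auto cong: continuous_on_cong)
next
  case (Suc j)
  then obtain f' where f': "\<And>z. z \<in> S \<Longrightarrow> (f has_derivative f' z) (at z within S)"
    and C: "\<And>h. Ck_on j S (\<lambda>z. f' z h)"
    using assms(2) by auto
  have "(g has_derivative f' z) (at z within S)" if "z \<in> S" for z
    using f'[OF that] that assms(1) by (metis has_derivative_transform)
  then show ?thesis using C Suc by auto
qed

lemma Ck_on_SucD: "Ck_on (Suc k) S f \<Longrightarrow> Ck_on k S f"
proof (induction k arbitrary: f)
  case 0
  then show ?case by (auto intro: has_derivative_continuous_on)
next
  case (Suc k)
  from Suc.prems obtain f' where f': "\<And>z. z \<in> S \<Longrightarrow> (f has_derivative f' z) (at z within S)"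
    and C: "\<And>h. Ck_on (Suc k) S (\<lambda>z. f' z h)"
    by (metis Ck_on.simps(2))
  have "\<And>h. Ck_on k S (\<lambda>z. f' z h)"
    using Suc.IH C by blast
  with f' show ?case by auto
qed

lemma Ck_on_le: "j \<le> k \<Longrightarrow> Ck_on k S f \<Longrightarrow> Ck_on j S f"
  by (induction rule: inc_induct) (auto simp del: Ck_on.simps dest: Ck_on_SucD)

lemma Ck_on_continuous_on: "Ck_on k S f \<Longrightarrow> continuous_on S f"
  using Ck_on_le[of 0 k S f] by simp

lemma Ck_on_const: "Ck_on k S (\<lambda>z. c)"
proof (induction k arbitrary: c)
  case (Suc k)
  show ?case using Suc[of 0] by (auto intro!: exI[of _ "\<lambda>z h. 0"])
qed simp

lemma Ck_on_bounded_linear: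
  assumes "bounded_linear L"
  shows "Ck_on k S f \<Longrightarrow> Ck_on k S (\<lambda>z. L (f z))"
proof (induction k arbitrary: f)
  case 0
  then show ?case using bounded_linear.continuous_on[OF assms] by auto
next
  case (Suc k)
  then obtain f' where "\<And>z. z \<in> S \<Longrightarrow> (f has_derivative f' z) (at z within S)"
    and "\<And>h. Ck_on k S (\<lambda>z. f' z h)"
    by auto
  with Suc.IH show ?case
    by (auto intro!: exI[of _ "\<lambda>z h. L (f' z h)"] bounded_linear.has_derivative[OF assms])
qed

lemma Ck_on_add:
  "Ck_on k S f \<Longrightarrow> Ck_on k S g \<Longrightarrow> Ck_on k S (\<lambda>z. f z + g z)"
proof (induction k arbitrary: f g)
  case 0
  then show ?case by (auto intro: continuous_on_add)
next
  case (Suc k)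
  obtain f' where f': "\<And>z. z \<in> S \<Longrightarrow> (f has_derivative f' z) (at z within S)"
    "\<And>h. Ck_on k S (\<lambda>z. f' z h)"
    using Suc.prems(1) by auto
  obtain g' where g': "\<And>z. z \<in> S \<Longrightarrow> (g has_derivative g' z) (at z within S)"
    "\<And>h. Ck_on k S (\<lambda>z. g' z h)"
    using Suc.prems(2) by auto
  with f' Suc.IH show ?case
    by (auto intro!: exI[of _ "\<lambda>z h. f' z h + g' z h"] has_derivative_add)
qed

lemma Ck_on_mult:
  fixes f g :: "'a::euclidean_space \<Rightarrow> real"
  shows "Ck_on k S f \<Longrightarrow> Ck_on k S g \<Longrightarrow> Ck_on k S (\<lambda>z. f z * g z)"
proof (induction k arbitrary: f g)
  case 0
  then show ?case by (auto intro: continuous_on_mult)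
next
  case (Suc k)
  obtain f' where f': "\<And>z. z \<in> S \<Longrightarrow> (f has_derivative f' z) (at z within S)"
    "\<And>h. Ck_on k S (\<lambda>z. f' z h)"
    using Suc.prems(1) by auto
  obtain g' where g': "\<And>z. z \<in> S \<Longrightarrow> (g has_derivative g' z) (at z within S)"
    "\<And>h. Ck_on k S (\<lambda>z. g' z h)"
    using Suc.prems(2) by auto
  note D = f' g'
  have "Ck_on k S (\<lambda>z. f z * g' z h + f' z h * g z)" for h
    using D Suc.IH Ck_on_SucD[OF Suc.prems(1)] Ck_on_SucD[OF Suc.prems(2)]
    by (intro Ck_on_add) auto
  with D show ?case
    by (auto intro!: exI[of _ "\<lambda>z h. f z * g' z h + f' z h * g z"] has_derivative_mult)
qed

text \<open>
  The derivative of the composition in direction \<open>h\<close> is again a function composed with the same affine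
  map, so the induction needs no chain rule for higher derivatives.
\<close>

lemma Ck_on_compose_affine:
  assumes A: "bounded_linear A"
  shows "Ck_on k UNIV f \<Longrightarrow> Ck_on k S (\<lambda>z. f (A z + b))"
proof (induction k arbitrary: f)
  case 0
  then show ?case
    by (auto intro!: continuous_intros bounded_linear.continuous_on[OF A]
        intro: continuous_on_compose2[of UNIV f])
next
  case (Suc k)
  then obtain f' where f': "\<And>z. (f has_derivative f' z) (at z)"
    and C: "\<And>h. Ck_on k UNIV (\<lambda>z. f' z h)"
    by auto
  have "((\<lambda>z. A z + b) has_derivative A) (at z within S)" for z
    by (auto intro!: derivative_eq_intros bounded_linear.has_derivative[OF A])
  then have "((\<lambda>z. f (A z + b)) has_derivative (\<lambda>h. f' (A z + b) (A h))) (at z within S)" for z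
    using f' by (rule has_derivative_compose)
  with Suc.IH[OF C] show ?case
    by (auto intro!: exI[of _ "\<lambda>z h. f' (A z + b) (A h)"])
qed

text \<open>
  Disjoint open neighbourhoods make the derivative within the union agree with the derivative within
  each piece; the two sides of the fracture are such pieces.
\<close>

lemma Ck_on_union_separated:
  assumes "open P" "open Q" "P \<inter> Q = {}" "S \<subseteq> P" "T \<subseteq> Q"
  shows "Ck_on k S f \<Longrightarrow> Ck_on k T f \<Longrightarrow> Ck_on k (S \<union> T) f"
proof (induction k arbitrary: f)
  case 0
  have "openin (top_of_set (S \<union> T)) S" "openin (top_of_set (S \<union> T)) T"
    using assms by (auto simp: openin_open)
  with 0 show ?case by (auto intro: continuous_on_Un_local_open)
next
  case (Suc k)
  obtain f' where f': "\<And>z. z \<in> S \<Longrightarrow> (f has_derivative f' z) (at z within S)"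
    "\<And>h. Ck_on k S (\<lambda>z. f' z h)"
    using Suc.prems(1) by auto
  obtain g' where g': "\<And>z. z \<in> T \<Longrightarrow> (f has_derivative g' z) (at z within T)"
    "\<And>h. Ck_on k T (\<lambda>z. g' z h)"
    using Suc.prems(2) by auto
  note D = f' g'
  define F where "F = (\<lambda>z. if z \<in> P then f' z else g' z)"
  have FP: "F z = f' z" if "z \<in> S" for z using that assms by (auto simp: F_def)
  have FQ: "F z = g' z" if "z \<in> T" for z using that assms by (auto simp: F_def)
  have "Ck_on k S (\<lambda>z. F z h)" "Ck_on k T (\<lambda>z. F z h)" for h
    using D(2)[of h] D(4)[of h] FP FQ by (auto elim!: Ck_on_cong[rotated])
  then have 1: "Ck_on k (S \<union> T) (\<lambda>z. F z h)" for h by (intro Suc.IH)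
  have "(f has_derivative F z) (at z within S \<union> T)" if "z \<in> S \<union> T" for z
  proof (cases "z \<in> S")
    case True
    then have "at z within S \<union> T = at z within S"
      using assms by (intro at_within_nhd[of z P]) auto
    then show ?thesis using D(1)[OF True] FP[OF True] by simp
  next
    case False
    then have z: "z \<in> T" using that by auto
    then have "at z within S \<union> T = at z within T"
      using assms by (intro at_within_nhd[of z Q]) auto
    then show ?thesis using D(3)[OF z] FQ[OF z] by simp
  qed
  with 1 show ?case by auto
qed

lemma Ck_on_antiderivative:
  fixes y g :: "real \<Rightarrow> real"
  assumes "\<And>t. (y has_real_derivative g t) (at t)" and "Ck_on k UNIV g"
  shows "Ck_on (Suc k) UNIV y"
proof -
  have "Ck_on k UNIV (\<lambda>t. g t * h)" for h
    using assms(2) by (intro Ck_on_mult Ck_on_const)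
  then show ?thesis
    using assms(1) by (auto simp: has_field_derivative_def intro!: exI[of _ "\<lambda>t h. g t * h"])
qed

lemma Ck_on_real_derivative:
  fixes f :: "real \<Rightarrow> real"
  assumes "Ck_on k UNIV f" and "k \<ge> 1"
  shows "(f has_real_derivative deriv f x) (at x)"
proof -
  have "Ck_on (Suc 0) UNIV f" using assms by (auto intro: Ck_on_le simp del: Ck_on.simps)
  then have "f differentiable (at x)" by (auto simp: differentiable_def)
  then show ?thesis
    using DERIV_deriv_iff_real_differentiable by blast
qed

section \<open>Scalar ordinary differential equations\<close>

text \<open>
  Picard iteration on the whole half-line at once: with \<open>y(t) = w(t) u(t)\<close> and the weight
  \<open>w(t) = exp (2 L (t - t0))\<close>, the integral operator halves distances in the space of bounded
  continuous \<open>u\<close>. The extension by \<open>y0\<close> to earlier times keeps \<open>u\<close> a function on the whole line.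
\<close>

lemma bounded_lipschitz_ode_solution:
  fixes F :: "real \<Rightarrow> real \<Rightarrow> real"
  assumes cont: "continuous_on UNIV (\<lambda>(t, y). F t y)"
    and bound: "\<And>t y. \<bar>F t y\<bar> \<le> B"
    and lip: "\<And>t y z. \<bar>F t y - F t z\<bar> \<le> L * \<bar>y - z\<bar>" and "L > 0"
  obtains y where "\<And>t. t \<le> t0 \<Longrightarrow> y t = y0"
    and "\<And>t. t \<ge> t0 \<Longrightarrow> (y has_real_derivative F t (y t)) (at t within {t0..})"
proof -
  define w where "w t = exp (2 * L * (t - t0))" for t
  have w_pos: "w t > 0" for t by (simp add: w_def)
  have w_cont: "continuous_on S w" for S unfolding w_def by (intro continuous_intros)
  define I where "I u t = integral {t0..max t0 t} (\<lambda>s. F s (w s * u s))"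
    for u :: "real \<Rightarrow>\<^sub>C real" and t
  define T where "T u t = (y0 + I u t) / w (max t0 t)" for u t
  have F_cont: "continuous_on S (\<lambda>s. F s (w s * apply_bcontfun u s))" for S and u :: "real \<Rightarrow>\<^sub>C real"
  proof -
    have "continuous_on S (\<lambda>s. (s, w s * apply_bcontfun u s))"
      by (auto intro!: continuous_intros w_cont)
    from continuous_on_compose2[OF cont this] show ?thesis by simp
  qed
  have F_int: "(\<lambda>s. F s (w s * apply_bcontfun u s)) integrable_on {a..b}"
    for a b and u :: "real \<Rightarrow>\<^sub>C real"
    by (intro integrable_continuous_real F_cont)
  have I_deriv: "(I u has_real_derivative F t (w t * u t)) (at t within {t0..})" if "t \<ge> t0" for u t
  proof -
    have "((\<lambda>x. integral {t0..x} (\<lambda>s. F s (w s * u s))) has_real_derivative F t (w t * u t))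
      (at t within {t0..t+1})"
      using that by (intro integral_has_real_derivative F_cont) auto
    then have "(I u has_real_derivative F t (w t * u t)) (at t within {t0..t+1})"
      by (rule has_field_derivative_transform_within[where d = 1]) (use that in \<open>auto simp: I_def\<close>)
    also have "at t within {t0..t+1} = at t within {t0..}"
      using that by (intro at_within_nhd[of t "{..<t+1}"]) auto
    finally show ?thesis .
  qed
  have I_max: "I u (max t0 t) = I u t" for u t by (simp add: I_def)
  have I_cont: "continuous_on UNIV (I u)" for u
  proof -
    have "continuous_on {t0..} (I u)"
      by (rule DERIV_continuous_on[where D = "\<lambda>t. F t (w t * u t)"]) (simp add: I_deriv)
    then have "continuous_on UNIV (\<lambda>t. I u (max t0 t))"
      by (rule continuous_on_compose2) (auto intro!: continuous_intros)
    then show ?thesis by (simp add: I_max)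
  qed
  have T_cont: "continuous_on UNIV (T u)" for u
  proof -
    have "continuous_on UNIV (\<lambda>t. w (max t0 t))"
      by (rule continuous_on_compose2[OF w_cont[of UNIV]]) (auto intro!: continuous_intros)
    then show ?thesis
      unfolding T_def using w_pos
      by (intro continuous_on_divide continuous_on_add continuous_on_const I_cont)
         (auto simp: less_imp_neq[symmetric])
  qed
  have w_ge: "w t \<ge> 1" "w t \<ge> 2 * L * (t - t0)" if "t \<ge> t0" for t
    using exp_ge_add_one_self[of "2 * L * (t - t0)"] mult_nonneg_nonneg[of "2 * L" "t - t0"]
      that \<open>L > 0\<close> unfolding w_def by linarith+
  have I_bound: "\<bar>I u t\<bar> \<le> B * (max t0 t - t0)" for u t
    using integral_bound[of t0 "max t0 t" "\<lambda>s. F s (w s * u s)" B] F_cont bound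
    by (auto simp: I_def)
  have B0: "B \<ge> 0" using bound[of 0 0] by linarith
  have T_bound: "\<bar>T u t\<bar> \<le> \<bar>y0\<bar> + B / (2 * L)" for u t
  proof -
    let ?m = "max t0 t"
    have "\<bar>T u t\<bar> \<le> (\<bar>y0\<bar> + B * (?m - t0)) / w ?m"
      using I_bound[of u t] w_pos[of ?m] unfolding T_def
      by (auto simp: abs_divide intro!: divide_right_mono)
    also have "\<dots> \<le> \<bar>y0\<bar> + B / (2 * L)"
    proof -
      have "B / (2 * L) * (2 * L * (?m - t0)) \<le> B / (2 * L) * w ?m"
        using B0 \<open>L > 0\<close> by (intro mult_left_mono w_ge) auto
      moreover have "B / (2 * L) * (2 * L * (?m - t0)) = B * (?m - t0)"
        using \<open>L > 0\<close> by simp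
      moreover have "\<bar>y0\<bar> \<le> \<bar>y0\<bar> * w ?m"
        using mult_left_mono[OF w_ge(1)[of ?m], of "\<bar>y0\<bar>"] by auto
      ultimately show ?thesis
        using w_pos[of ?m] by (simp add: pos_divide_le_eq distrib_right)
    qed
    finally show ?thesis .
  qed
  have T_in: "T u \<in> bcontfun" for u
    using T_cont T_bound by (auto intro!: bcontfun_normI)
  define \<Phi> where "\<Phi> u = Bcontfun (T u)" for u
  have \<Phi>: "apply_bcontfun (\<Phi> u) t = T u t" for u t
    by (simp add: \<Phi>_def Bcontfun_inverse[OF T_in])
  have contraction: "dist (\<Phi> u) (\<Phi> v) \<le> 1/2 * dist u v" for u v
  proof (rule dist_bound)
    fix t
    let ?m = "max t0 t" and ?D = "dist u v"
    \<comment> \<open>The factor \<open>1/2\<close>: \<open>2 L\<close> in the exponent of \<open>w\<close> makes \<open>w / 2\<close> a primitive of \<open>L w\<close>.\<close>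
    have w_int: "((\<lambda>s. L * ?D * w s) has_integral ?D / 2 * w ?m - ?D / 2 * w t0) {t0..?m}"
    proof (rule fundamental_theorem_of_calculus)
      fix s
      show "((\<lambda>s. ?D / 2 * w s) has_vector_derivative L * ?D * w s) (at s within {t0..?m})"
        unfolding w_def has_real_derivative_iff_has_vector_derivative[symmetric]
        by (auto intro!: derivative_eq_intros)
    qed simp
    have "\<bar>I u t - I v t\<bar>
        = \<bar>integral {t0..?m} (\<lambda>s. F s (w s * u s) - F s (w s * v s))\<bar>"
      unfolding I_def by (subst integral_diff) (auto intro: F_int)
    also have "\<dots> \<le> integral {t0..?m} (\<lambda>s. L * ?D * w s)"
    proof (rule integral_norm_bound_integral[where 'a = real, unfolded real_norm_def])
      show "(\<lambda>s. F s (w s * u s) - F s (w s * v s)) integrable_on {t0..?m}"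
        by (intro integrable_diff F_int)
      show "(\<lambda>s. L * ?D * w s) integrable_on {t0..?m}" using w_int by blast
      fix s
      have "\<bar>w s * u s - w s * v s\<bar> \<le> w s * ?D"
        using dist_bounded[of u s v] w_pos[of s]
        by (simp add: right_diff_distrib[symmetric] abs_mult dist_real_def)
      then have "L * \<bar>w s * u s - w s * v s\<bar> \<le> L * (w s * ?D)"
        using \<open>L > 0\<close> by simp
      then show "\<bar>F s (w s * u s) - F s (w s * v s)\<bar> \<le> L * ?D * w s"
        using lip[of s "w s * u s" "w s * v s"] by (simp add: mult.commute mult.left_commute)
    qed
    also have "\<dots> = ?D / 2 * w ?m - ?D / 2 * w t0" using w_int by (rule integral_unique)
    also have "\<dots> \<le> ?D / 2 * w ?m" using w_pos[of t0] by simp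
    finally have "\<bar>I u t - I v t\<bar> / w ?m \<le> ?D / 2"
      using w_pos[of ?m] by (simp add: pos_divide_le_eq)
    moreover have "T u t - T v t = (I u t - I v t) / w ?m"
      by (simp add: T_def diff_divide_distrib[symmetric])
    ultimately show "dist (\<Phi> u t) (\<Phi> v t) \<le> 1/2 * ?D"
      using w_pos[of ?m] by (simp add: \<Phi> dist_real_def abs_divide)
  qed
  obtain u where u: "\<Phi> u = u"
    using banach_fix_type[of "1/2" \<Phi>] contraction by auto
  define y where "y t = y0 + I u t" for t
  have y: "y t = w t * u t" if "t \<ge> t0" for t
    using \<Phi>[of u t] u w_pos[of t] that by (simp add: y_def T_def)
  show thesis
  proof
    show "y t = y0" if "t \<le> t0" for t using that by (simp add: y_def I_def)
    show "(y has_real_derivative F t (y t)) (at t within {t0..})" if "t \<ge> t0" for t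
      unfolding y[OF that] unfolding y_def by (auto intro!: derivative_eq_intros I_deriv that)
  qed
qed

text \<open>
  The solution over its integrating factor has zero derivative.
\<close>

lemma linear_ode_solution:
  fixes e a :: "real \<Rightarrow> real"
  assumes "\<And>t. t \<ge> t0 \<Longrightarrow> (e has_real_derivative a t * e t) (at t within {t0..})"
    and "continuous_on {t0..} a" and "t \<ge> t0"
  shows "e t = e t0 * exp (integral {t0..t} a)"
proof -
  define A where "A s = integral {t0..s} a" for s
  have a: "continuous_on {t0..t} a"
    using assms(2) by (rule continuous_on_subset) auto
  have "((\<lambda>s. e s * exp (- A s)) has_real_derivative 0) (at s within {t0..t})" if "s \<in> {t0..t}" for s
  proof -
    have 1: "(A has_real_derivative a s) (at s within {t0..t})"
      unfolding A_def using a that by (rule integral_has_real_derivative)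
    have 2: "(e has_real_derivative a s * e s) (at s within {t0..t})"
      using assms(1)[of s] that by (auto intro: has_field_derivative_subset)
    show ?thesis by (auto intro!: derivative_eq_intros 1 2)
  qed
  then obtain c where "\<And>s. s \<in> {t0..t} \<Longrightarrow> e s * exp (- A s) = c"
    using has_field_derivative_zero_constant[of "{t0..t}" "\<lambda>s. e s * exp (- A s)"] by auto
  then have "e t * exp (- A t) = e t0 * exp (- A t0)"
    using assms(3) by simp
  then show ?thesis by (simp add: A_def exp_minus field_simps)
qed

text \<open>
  After the last time at or below \<open>b\<close> the function could only decrease.
\<close>

lemma upper_barrier:
  fixes y :: "real \<Rightarrow> real"
  assumes "\<And>t. t \<ge> t0 \<Longrightarrow> (y has_real_derivative y' t) (at t within {t0..})"
    and "\<And>t. t \<ge> t0 \<Longrightarrow> y t > b \<Longrightarrow> y' t \<le> 0"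
    and "y t0 \<le> b" and "t \<ge> t0"
  shows "y t \<le> b"
proof (rule ccontr)
  assume "\<not> y t \<le> b"
  have cont: "continuous_on {t0..} y"
    by (rule DERIV_continuous_on[where D = y']) (simp add: assms(1))
  define S where "S = {s \<in> {t0..t}. y s \<le> b}"
  have "compact S"
  proof -
    have "continuous_on {t0..t} y" using cont by (rule continuous_on_subset) auto
    then have "closed S"
      unfolding S_def by (intro continuous_on_closed_Collect_le) (auto intro: continuous_intros)
    moreover have "bounded S" unfolding S_def by (rule bounded_subset[OF bounded_closed_interval[of t0 t]]) auto
    ultimately show ?thesis by (simp add: compact_eq_bounded_closed)
  qed
  moreover have "t0 \<in> S" using assms by (auto simp: S_def)
  ultimately obtain m where m: "m \<in> S" "\<And>s. s \<in> S \<Longrightarrow> s \<le> m"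
    using compact_attains_sup[of S] by auto
  have above: "y s > b" if "m < s" "s \<le> t" for s
    using m(2)[of s] m(1) that by (fastforce simp: S_def)
  have "m < t" using m(1) \<open>\<not> y t \<le> b\<close> by (auto simp: S_def less_le)
  have "y t \<le> y m"
  proof (rule DERIV_nonpos_imp_decreasing_open[OF less_imp_le[OF \<open>m < t\<close>]])
    show "continuous_on {m..t} y" using cont by (rule continuous_on_subset) (use m in \<open>auto simp: S_def\<close>)
    fix s assume s: "m < s" "s < t"
    then have "s > t0" using m by (auto simp: S_def)
    then have "(y has_real_derivative y' s) (at s)"
      using assms(1)[of s] at_within_interior[of s "{t0..}"] by (simp add: interior_Ici)
    then show "\<exists>z. (y has_real_derivative z) (at s) \<and> z \<le> 0"
      using assms(2)[of s] above[of s] s \<open>s > t0\<close> by auto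
  qed
  then show False using m(1) \<open>\<not> y t \<le> b\<close> by (auto simp: S_def)
qed

section \<open>The equation for the stress at the fracture\<close>

text \<open>
  Right-hand side of the equation for the stress \<open>s\<close> at the fracture, for an incident
  amplitude \<open>q\<close>.
\<close>

definition stress_rate :: "real \<Rightarrow> real \<Rightarrow> real \<Rightarrow> real \<Rightarrow> real \<Rightarrow> real" where
  "stress_rate K d \<beta> q s = K * (1 - s / (K * d))\<^sup>2 * (- q - \<beta> * s)"

text \<open>
  Difference quotient of the cubic polynomial \<open>stress_rate\<close> in its last argument, written as a
  polynomial so that it is also continuous where \<open>a = b\<close>.
\<close>

definition stress_rate_slope :: "real \<Rightarrow> real \<Rightarrow> real \<Rightarrow> real \<Rightarrow> real \<Rightarrow> real \<Rightarrow> real" where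
  "stress_rate_slope K d \<beta> q a b =
     - K * ((2 - a / (K * d) - b / (K * d)) / (K * d) * (- q - \<beta> * a) + (1 - b / (K * d))\<^sup>2 * \<beta>)"

lemma stress_rate_diff:
  "stress_rate K d \<beta> q a - stress_rate K d \<beta> q b = stress_rate_slope K d \<beta> q a b * (a - b)"
  unfolding stress_rate_def stress_rate_slope_def divide_inverse by algebra

lemma stress_rate_at_limit: "K > 0 \<Longrightarrow> d > 0 \<Longrightarrow> stress_rate K d \<beta> q (K * d) = 0"
  by (simp add: stress_rate_def)

lemma continuous_on_stress_rate:
  assumes "continuous_on X q" "continuous_on X s"
  shows "continuous_on X (\<lambda>x. stress_rate K d \<beta> (q x) (s x))"
  unfolding stress_rate_def divide_inverse using assms by (intro continuous_intros)

lemma continuous_on_stress_rate_slope: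
  assumes "continuous_on X q" "continuous_on X a" "continuous_on X b"
  shows "continuous_on X (\<lambda>x. stress_rate_slope K d \<beta> (q x) (a x) (b x))"
  unfolding stress_rate_slope_def divide_inverse using assms by (intro continuous_intros)

text \<open>
  The difference of two solutions solves a linear equation whose coefficient is the difference
  quotient, hence it never changes sign.
\<close>

lemma stress_ode_difference:
  assumes "continuous_on {t0..} q"
    and a: "\<And>t. t \<ge> t0 \<Longrightarrow>
      (a has_real_derivative stress_rate K d \<beta> (q t) (a t)) (at t within {t0..})"
    and b: "\<And>t. t \<ge> t0 \<Longrightarrow>
      (b has_real_derivative stress_rate K d \<beta> (q t) (b t)) (at t within {t0..})"
    and "t \<ge> t0"
  obtains g where "g > 0" "a t - b t = (a t0 - b t0) * g"
proof -
  have "continuous_on {t0..} a" "continuous_on {t0..} b"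
    using a b by (auto intro!: DERIV_continuous_on)
  then have "continuous_on {t0..} (\<lambda>t. stress_rate_slope K d \<beta> (q t) (a t) (b t))"
    using assms(1) by (intro continuous_on_stress_rate_slope)
  moreover have "((\<lambda>t. a t - b t) has_real_derivative
      stress_rate_slope K d \<beta> (q t) (a t) (b t) * (a t - b t)) (at t within {t0..})"
    if "t \<ge> t0" for t
    using DERIV_diff[OF a[OF that] b[OF that]] by (simp add: stress_rate_diff)
  ultimately have "a t - b t
      = (a t0 - b t0) * exp (integral {t0..t} (\<lambda>t. stress_rate_slope K d \<beta> (q t) (a t) (b t)))"
    using \<open>t \<ge> t0\<close> by (intro linear_ode_solution)
  then show thesis by (intro that) auto
qed

lemma stress_ode_unique:
  assumes "continuous_on {t0..} q"
    and "\<And>t. t \<ge> t0 \<Longrightarrow>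
      (a has_real_derivative stress_rate K d \<beta> (q t) (a t)) (at t within {t0..})"
    and "\<And>t. t \<ge> t0 \<Longrightarrow>
      (b has_real_derivative stress_rate K d \<beta> (q t) (b t)) (at t within {t0..})"
    and "a t0 = b t0" and "t \<ge> t0"
  shows "a t = b t"
  using stress_ode_difference[OF assms(1-3) assms(5)] assms(4) by auto

lemma DERIV_split_point:
  fixes f :: "real \<Rightarrow> real"
  assumes "(f has_real_derivative D) (at a within {a..})"
    and "(f has_real_derivative D) (at a within {..a})"
  shows "(f has_real_derivative D) (at a)"
proof -
  have "{a..} \<union> {..a} = UNIV" by auto
  then have "at a = sup (at a within {a..}) (at a within {..a})"
    by (metis at_within_union)
  then show ?thesis using assms unfolding has_field_derivative_iff by (metis filterlim_sup)
qed

text \<open>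
  With \<open>m = M / \<beta>\<close>, the right-hand side is nonnegative at and below \<open>- m\<close> and vanishes at \<open>K d\<close>.
  Clamping the stress to this range makes the equation Lipschitz, and the same two signs keep the
  solution of the clamped equation in the range, where both equations agree. Comparison with the
  constant solution \<open>K d\<close> makes the upper bound strict.
\<close>

lemma stress_ode_solution:
  assumes pos: "K > 0" "d > 0" "\<beta> > 0"
    and q_cont: "continuous_on UNIV q" and q_bound: "\<And>t. \<bar>q t\<bar> \<le> M"
    and q_zero: "\<And>t. t \<le> t0 \<Longrightarrow> q t = 0"
  obtains S where "\<And>t. t \<le> t0 \<Longrightarrow> S t = 0"
    and "\<And>t. (S has_real_derivative stress_rate K d \<beta> (q t) (S t)) (at t)"
    and "\<And>t. S t < K * d"
proof -
  define m where "m = M / \<beta>"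
  have "M \<ge> 0" using q_bound[of 0] by linarith
  then have m: "m \<ge> 0" "M = \<beta> * m" using pos by (auto simp: m_def)
  define clamp where "clamp y = max (- m) (min (K * d) y)" for y
  have clamp: "clamp y \<in> {- m..K * d}" for y
    using m mult_pos_pos[OF pos(1,2)] by (auto simp: clamp_def)
  have clamp_lip: "\<bar>clamp y - clamp z\<bar> \<le> \<bar>y - z\<bar>" for y z
    by (simp add: clamp_def max_def min_def abs_if)
  have clamp_id: "clamp y = y" if "- m \<le> y" "y \<le> K * d" for y
    using that by (auto simp: clamp_def)
  define F where "F t y = stress_rate K d \<beta> (q t) (clamp y)" for t y
  have F_cont: "continuous_on UNIV (\<lambda>(t, y). F t y)"
    unfolding F_def clamp_def case_prod_beta
    by (intro continuous_on_stress_rate continuous_on_compose2[OF q_cont]) (auto intro!: continuous_intros)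
  \<comment> \<open>The bound and the Lipschitz constant come from compactness of the range of the arguments.\<close>
  define Q where "Q = {- M..M} \<times> {- m..K * d} \<times> {- m..K * d}"
  have "compact Q" unfolding Q_def by (intro compact_Times compact_Icc)
  have in_Q: "(q t, clamp y, clamp z) \<in> Q" for t y z
    using q_bound[of t] clamp[of y] clamp[of z] by (auto simp: Q_def abs_le_iff)
  have "continuous_on Q (\<lambda>z. stress_rate K d \<beta> (fst z) (fst (snd z)))"
    by (intro continuous_on_stress_rate continuous_intros)
  from compact_imp_bounded[OF compact_continuous_image[OF this \<open>compact Q\<close>]]
  obtain B where B: "\<And>z. z \<in> Q \<Longrightarrow> \<bar>stress_rate K d \<beta> (fst z) (fst (snd z))\<bar> \<le> B"
    by (auto simp: bounded_iff)
  have F_bound: "\<bar>F t y\<bar> \<le> B" for t y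
    using B[OF in_Q[of t y y]] by (simp add: F_def)
  have "continuous_on Q (\<lambda>z. stress_rate_slope K d \<beta> (fst z) (fst (snd z)) (snd (snd z)))"
    by (intro continuous_on_stress_rate_slope continuous_intros)
  from compact_imp_bounded[OF compact_continuous_image[OF this \<open>compact Q\<close>]]
  obtain L where L: "\<And>z. z \<in> Q \<Longrightarrow>
      \<bar>stress_rate_slope K d \<beta> (fst z) (fst (snd z)) (snd (snd z))\<bar> \<le> L"
    by (auto simp: bounded_iff)
  have F_lip: "\<bar>F t y - F t z\<bar> \<le> max L 1 * \<bar>y - z\<bar>" for t y z
  proof -
    have "\<bar>F t y - F t z\<bar>
        = \<bar>stress_rate_slope K d \<beta> (q t) (clamp y) (clamp z)\<bar> * \<bar>clamp y - clamp z\<bar>"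
      by (simp add: F_def stress_rate_diff abs_mult)
    also have "\<dots> \<le> max L 1 * \<bar>y - z\<bar>"
      using L[OF in_Q[of t y z]] clamp_lip[of y z] by (intro mult_mono) auto
    finally show ?thesis .
  qed
  obtain S where S_init: "\<And>t. t \<le> t0 \<Longrightarrow> S t = 0"
    and S_ode: "\<And>t. t \<ge> t0 \<Longrightarrow> (S has_real_derivative F t (S t)) (at t within {t0..})"
    by (rule bounded_lipschitz_ode_solution[OF F_cont F_bound F_lip, of t0 0]) auto
  have S_le: "S t \<le> K * d" if "t \<ge> t0" for t
  proof (rule upper_barrier[OF S_ode])
    fix t assume "S t > K * d"
    then have "clamp (S t) = K * d" using m mult_pos_pos[OF pos(1,2)] by (auto simp: clamp_def)
    then show "F t (S t) \<le> 0" using pos by (simp add: F_def stress_rate_at_limit)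
  qed (use S_init pos that in auto)
  have minus_ode: "((\<lambda>t. - S t) has_real_derivative - F t (S t)) (at t within {t0..})"
    if "t \<ge> t0" for t
    using S_ode[OF that] by (rule DERIV_minus)
  have S_ge: "- S t \<le> m" if "t \<ge> t0" for t
  proof (rule upper_barrier[OF minus_ode])
    fix t assume "- S t > m"
    then have "clamp (S t) = - m" using m mult_pos_pos[OF pos(1,2)] by (auto simp: clamp_def)
    moreover have "- q t - \<beta> * (- m) \<ge> 0" using q_bound[of t] m(2) by simp
    ultimately have "F t (S t) \<ge> 0"
      using pos unfolding F_def stress_rate_def by (metis mult_nonneg_nonneg less_imp_le zero_le_power2)
    then show "- F t (S t) \<le> 0" by simp
  qed (use S_init m that in auto)
  have F_S: "F t (S t) = stress_rate K d \<beta> (q t) (S t)" if "t \<ge> t0" for t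
    using S_le[OF that] S_ge[OF that] by (simp add: F_def clamp_id)
  have ode: "(S has_real_derivative stress_rate K d \<beta> (q t) (S t)) (at t within {t0..})"
    if "t \<ge> t0" for t
    using S_ode[OF that] F_S[OF that] by simp
  have S_less: "S t < K * d" for t
  proof (cases "t \<ge> t0")
    case True
    have "continuous_on {t0..} q" using q_cont by (rule continuous_on_subset) simp
    then obtain g where "g > 0" "S t - K * d = (S t0 - K * d) * g"
      by (rule stress_ode_difference[OF _ ode, where b = "\<lambda>t. K * d"])
        (use pos True in \<open>auto simp: stress_rate_at_limit\<close>)
    moreover have "S t0 - K * d < 0" using S_init pos by simp
    ultimately show ?thesis by (metis mult_neg_pos diff_less_0_iff_less)
  qed (use S_init pos in auto)
  have rate0: "stress_rate K d \<beta> (q t) (S t) = 0" if "t \<le> t0" for t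
    using that by (simp add: stress_rate_def q_zero S_init)
  have zero: "(S has_real_derivative 0) (at t within {..t0})" if "t \<le> t0" for t
    by (rule has_field_derivative_transform_within[where d = 1 and f = "\<lambda>_. 0"])
      (use that in \<open>auto simp: S_init\<close>)
  \<comment> \<open>At \<open>t0\<close> both one-sided derivatives are zero, since \<open>q\<close> and \<open>S\<close> vanish there.\<close>
  have "(S has_real_derivative stress_rate K d \<beta> (q t) (S t)) (at t)" for t
  proof (cases t t0 rule: linorder_cases)
    case less
    then have "at t within {..t0} = at t" by (intro at_within_interior) simp
    then show ?thesis using zero[of t] rate0[of t] less by simp
  next
    case equal
    then show ?thesis using DERIV_split_point[of S _ t] ode[of t] zero[of t] rate0[of t] by simp
  next
    case greater
    then have "at t within {t0..} = at t" by (intro at_within_interior) simp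
    then show ?thesis using ode[of t] greater by simp
  qed
  then show thesis using that S_init S_less by blast
qed

text \<open>
  Bootstrapping: if \<open>S\<close> is \<open>C\<^sup>k\<close> with \<open>k \<le> p\<close>, its derivative is a polynomial in
  the \<open>C\<^sup>k\<close> functions \<open>q\<close> and \<open>S\<close>.
\<close>

lemma stress_ode_Ck:
  assumes S: "\<And>t. (S has_real_derivative stress_rate K d \<beta> (q t) (S t)) (at t)"
    and "Ck_on p UNIV q"
  shows "Ck_on p UNIV S"
proof -
  have "Ck_on k UNIV S" if "k \<le> p" for k
    using that
  proof (induction k)
    case 0
    show ?case using S by (auto intro!: DERIV_continuous_on)
  next
    case (Suc k)
    have q: "Ck_on k UNIV q" using Ck_on_le[OF _ assms(2)] Suc.prems by simp
    have s: "Ck_on k UNIV S" using Suc by simp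
    have "Ck_on k UNIV (\<lambda>t. 1 + - inverse (K * d) * S t)" "Ck_on k UNIV (\<lambda>t. - 1 * q t + - \<beta> * S t)"
      by (intro Ck_on_add Ck_on_mult Ck_on_const q s)+
    then have "Ck_on k UNIV (\<lambda>t. K * (1 + - inverse (K * d) * S t) * (1 + - inverse (K * d) * S t)
        * (- 1 * q t + - \<beta> * S t))"
      by (intro Ck_on_mult Ck_on_const)
    then have "Ck_on k UNIV (\<lambda>t. stress_rate K d \<beta> (q t) (S t))"
      by (simp add: stress_rate_def power2_eq_square divide_inverse mult.assoc mult.commute[of "S _"])
    then show ?case by (rule Ck_on_antiderivative[OF S])
  qed
  then show ?thesis by simp
qed

section \<open>Plane waves and Riemann invariants\<close>

text \<open>
  The Riemann invariant transported with velocity \<open>c\<close>. The velocity may be negative: the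
  left-going invariant is \<open>riemann \<rho> (- c)\<close>, because the coefficient matrix only sees \<open>c\<^sup>2\<close>.
  This lets each lemma cover both directions.
\<close>

definition riemann :: "real \<Rightarrow> real \<Rightarrow> real^2 \<Rightarrow> real" where
  "riemann \<rho> c u = u $ 1 - u $ 2 / (\<rho> * c)"

text \<open>
  Eigenvector of the coefficient matrix for the eigenvalue \<open>c\<close>, scaled to be dual to
  the Riemann invariants.
\<close>

definition eigenmode :: "real \<Rightarrow> real \<Rightarrow> real^2" where
  "eigenmode \<rho> c = vector [1/2, - (\<rho> * c) / 2]"

text \<open>
  d'Alembert's solution with right-going profile \<open>r\<close> and left-going profile \<open>l\<close>.
\<close>

definition wave :: "real \<Rightarrow> real \<Rightarrow> real \<Rightarrow> (real \<Rightarrow> real) \<Rightarrow> (real \<Rightarrow> real) \<Rightarrow> real \<times> real \<Rightarrow> real^2" where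
  "wave \<rho> c t0 r l z = r (fst z - c * (snd z - t0)) *\<^sub>R eigenmode \<rho> c
                      + l (fst z + c * (snd z - t0)) *\<^sub>R eigenmode \<rho> (- c)"

lemma vec2_eq_iff: "u = v \<longleftrightarrow> u $ 1 = v $ 1 \<and> u $ 2 = v $ 2" for u v :: "real^2"
  by (auto simp: vec_eq_iff forall_2)

lemma coeff_matrix_mult:
  "coeff_matrix \<rho> c *v u = vector [- u $ 2 / \<rho>, - (\<rho> * c\<^sup>2) * u $ 1]"
  by (simp add: vec2_eq_iff coeff_matrix_def matrix_vector_mult_def sum_2)

lemma coeff_matrix_uminus: "coeff_matrix \<rho> (- c) = coeff_matrix \<rho> c"
  by (simp add: coeff_matrix_def)

lemma coeff_matrix_eigenmode: "\<rho> \<noteq> 0 \<Longrightarrow> coeff_matrix \<rho> c *v eigenmode \<rho> c = c *\<^sub>R eigenmode \<rho> c"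
  by (simp add: coeff_matrix_mult eigenmode_def vec2_eq_iff power2_eq_square field_simps)

text \<open>
  The invariant is a left eigenvector of the coefficient matrix; this is what turns the system into
  transport equations.
\<close>

lemma riemann_coeff_matrix:
  "\<rho> \<noteq> 0 \<Longrightarrow> c \<noteq> 0 \<Longrightarrow> riemann \<rho> c (coeff_matrix \<rho> c *v u) = c * riemann \<rho> c u"
  by (simp add: coeff_matrix_mult riemann_def power2_eq_square field_simps)

lemma bounded_linear_riemann: "bounded_linear (riemann \<rho> c)"
  unfolding riemann_def divide_inverse
  by (intro bounded_linear_sub bounded_linear_compose[OF bounded_linear_mult_left] bounded_linear_vec_nth)

lemma riemann_decomposition:
  "\<rho> \<noteq> 0 \<Longrightarrow> c \<noteq> 0 \<Longrightarrow>
   u = riemann \<rho> c u *\<^sub>R eigenmode \<rho> c + riemann \<rho> (- c) u *\<^sub>R eigenmode \<rho> (- c)"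
  by (simp add: vec2_eq_iff riemann_def eigenmode_def field_simps)

lemma wave_has_derivative:
  assumes r: "\<And>\<xi>. (r has_real_derivative r' \<xi>) (at \<xi>)"
    and l: "\<And>\<xi>. (l has_real_derivative l' \<xi>) (at \<xi>)"
  shows "(wave \<rho> c t0 r l has_derivative
     (\<lambda>h. (r' (fst z - c * (snd z - t0)) * (fst h - c * snd h)) *\<^sub>R eigenmode \<rho> c
        + (l' (fst z + c * (snd z - t0)) * (fst h + c * snd h)) *\<^sub>R eigenmode \<rho> (- c))) (at z within S)"
proof -
  have "((\<lambda>z. r (fst z - c * (snd z - t0))) has_derivative
      (\<lambda>h. r' (fst z - c * (snd z - t0)) * (fst h - c * snd h))) (at z within S)"
    by (rule has_derivative_compose[OF _ r[unfolded has_field_derivative_def]])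
      (auto intro!: derivative_eq_intros)
  moreover have "((\<lambda>z. l (fst z + c * (snd z - t0))) has_derivative
      (\<lambda>h. l' (fst z + c * (snd z - t0)) * (fst h + c * snd h))) (at z within S)"
    by (rule has_derivative_compose[OF _ l[unfolded has_field_derivative_def]])
      (auto intro!: derivative_eq_intros)
  ultimately show ?thesis
    unfolding wave_def by (intro has_derivative_add has_derivative_scaleR_left)
qed

lemma Ck_on_wave:
  assumes "Ck_on k UNIV r" "Ck_on k UNIV l"
  shows "Ck_on k S (wave \<rho> c t0 r l)"
proof -
  have shift: "Ck_on k S (\<lambda>z. q (fst z + a * (snd z - t0)) *\<^sub>R e)" if "Ck_on k UNIV q"
    for q :: "real \<Rightarrow> real" and a and e :: "real^2"
  proof -
    have "bounded_linear (\<lambda>z. fst z + a * snd z)"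
      by (intro bounded_linear_add bounded_linear_fst
          bounded_linear_compose[OF bounded_linear_mult_right] bounded_linear_snd)
    from Ck_on_compose_affine[OF this that, of S "- a * t0"]
    have "Ck_on k S (\<lambda>z. q (fst z + a * (snd z - t0)))"
      by (simp add: algebra_simps)
    then show ?thesis by (rule Ck_on_bounded_linear[OF bounded_linear_scaleR_left])
  qed
  show ?thesis
    unfolding wave_def using Ck_on_add[OF shift[OF assms(1), of "- c"] shift[OF assms(2), of c]]
    by simp
qed

text \<open>
  Solutions on one side, with values up to the boundary. The equation is stated with the total
  derivative, whose values at \<open>(0, 1)\<close> and \<open>(1, 0)\<close> are the partial derivatives in \<open>t\<close> and \<open>x\<close>.
\<close>

definition wave_solution :: "real set \<Rightarrow> real \<Rightarrow> real \<Rightarrow> real \<Rightarrow> (real \<times> real \<Rightarrow> real^2) \<Rightarrow> bool" where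
  "wave_solution I t0 \<rho> c W \<longleftrightarrow>
     continuous_on (closure I \<times> {t0..}) W \<and>
     (\<forall>z \<in> I \<times> {t0..}. \<exists>D. (W has_derivative D) (at z within I \<times> {t0..}) \<and>
        D (0, 1) + coeff_matrix \<rho> c *v D (1, 0) = 0)"

lemma wave_solution_uminus: "wave_solution I t0 \<rho> (- c) W = wave_solution I t0 \<rho> c W"
  by (simp add: wave_solution_def coeff_matrix_uminus)

lemma wave_satisfies_system:
  assumes r: "\<And>\<xi>. (r has_real_derivative r' \<xi>) (at \<xi>)"
    and l: "\<And>\<xi>. (l has_real_derivative l' \<xi>) (at \<xi>)" and "\<rho> \<noteq> 0"
  shows "\<exists>D. (wave \<rho> c t0 r l has_derivative D) (at z within S) \<and>
      D (0, 1) + coeff_matrix \<rho> c *v D (1, 0) = 0"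
  using coeff_matrix_eigenmode[OF \<open>\<rho> \<noteq> 0\<close>, of c] coeff_matrix_eigenmode[OF \<open>\<rho> \<noteq> 0\<close>, of "- c"]
  by (intro exI[of _ "\<lambda>h. (r' (fst z - c * (snd z - t0)) * (fst h - c * snd h)) *\<^sub>R eigenmode \<rho> c
        + (l' (fst z + c * (snd z - t0)) * (fst h + c * snd h)) *\<^sub>R eigenmode \<rho> (- c)"]
      conjI wave_has_derivative r l)
    (simp add: coeff_matrix_uminus matrix_vector_right_distrib matrix_vector_mult_scaleR)

text \<open>
  Along a backward characteristic the derivative of the invariant is the equation multiplied by a
  left eigenvector. The equation is only used strictly inside the segment, so one endpoint may lie
  on the interface: this is how traces at the interface determine the solution inside, and
  conversely.
\<close>

lemma riemann_constant_on_characteristic: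
  assumes W: "wave_solution I t0 \<rho> c W" and I: "open I" "convex I"
    and nz: "\<rho> \<noteq> 0" "c \<noteq> 0"
    and x: "x \<in> closure I" "x - c * h \<in> closure I" "x \<in> I \<or> x - c * h \<in> I"
    and t: "h \<ge> 0" "t - h \<ge> t0"
  shows "riemann \<rho> c (W (x, t)) = riemann \<rho> c (W (x - c * h, t - h))"
proof (cases "h = 0")
  case False
  then have "h > 0" using t by simp
  have seg: "x - c * s \<in> open_segment x (x - c * h)" if "0 < s" "s < h" for s
  proof -
    have "x - c * s = (1 - s / h) *\<^sub>R x + (s / h) *\<^sub>R (x - c * h)"
      using \<open>h > 0\<close> by (simp add: field_simps)
    moreover have "x \<noteq> x - c * h" using nz \<open>h > 0\<close> by simp
    ultimately show ?thesis
      using that by (auto simp: in_segment intro!: exI[of _ "s / h"])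
  qed
  have "open_segment x (x - c * h) \<subseteq> interior I"
    using x I in_interior_closure_convex_segment[of I x "x - c * h"]
      in_interior_closure_convex_segment[of I "x - c * h" x]
    by (auto simp: interior_open open_segment_commute)
  then have inside: "x - c * s \<in> I" if "0 < s" "s < h" for s
    using seg[OF that] I interior_open by auto
  have closed: "x - c * s \<in> closure I" if "0 \<le> s" "s \<le> h" for s
    using inside[of s] x that closure_subset[of I] by (cases "s = 0 \<or> s = h") auto
  define \<phi> where "\<phi> s = riemann \<rho> c (W (x - c * s, t - s))" for s
  have "\<phi> h = \<phi> 0"
  proof (rule DERIV_isconst2[OF \<open>h > 0\<close>])
    have "continuous_on {0..h} (\<lambda>s. W (x - c * s, t - s))"
      using closed t
      by (intro continuous_on_compose2[OF conjunct1[OF W[unfolded wave_solution_def]]])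
        (auto intro!: continuous_intros)
    then show "continuous_on {0..h} \<phi>"
      unfolding \<phi>_def by (rule bounded_linear.continuous_on[OF bounded_linear_riemann])
    fix s assume s: "0 < s" "s < h"
    let ?z = "(x - c * s, t - s)"
    have z: "?z \<in> I \<times> {t0<..}" using inside[OF s] s t by auto
    then have "?z \<in> I \<times> {t0..}" by auto
    then obtain D where D: "(W has_derivative D) (at ?z within I \<times> {t0..})"
      and eq: "D (0, 1) + coeff_matrix \<rho> c *v D (1, 0) = 0"
      using W unfolding wave_solution_def by blast
    have "at ?z within I \<times> {t0..} = at ?z"
      using z I by (intro at_within_nhd[of _ "I \<times> {t0<..}" _ UNIV, simplified])
        (auto intro!: open_Times)
    with D have D': "(W has_derivative D) (at ?z)" by simp
    have "((\<lambda>s. (x - c * s, t - s)) has_derivative (\<lambda>k. k *\<^sub>R (- c, - 1))) (at s)"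
      by (auto intro!: derivative_eq_intros simp: mult.commute)
    from has_derivative_compose[OF this D']
    have "((\<lambda>s. W (x - c * s, t - s)) has_derivative (\<lambda>k. D (k *\<^sub>R (- c, - 1)))) (at s)" .
    from bounded_linear.has_derivative[OF bounded_linear_riemann this, of \<rho> c]
    have "(\<phi> has_derivative (\<lambda>k. riemann \<rho> c (D (k *\<^sub>R (- c, - 1))))) (at s)"
      unfolding \<phi>_def .
    moreover have "(\<lambda>k. riemann \<rho> c (D (k *\<^sub>R (- c, - 1)))) = (*) 0"
    proof
      fix k
      interpret D: bounded_linear D using D by (rule has_derivative_bounded_linear)
      interpret R: bounded_linear "riemann \<rho> c" by (rule bounded_linear_riemann)
      have "D (- c, - 1) = - (c *\<^sub>R D (1, 0) + D (0, 1))"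
        using D.add[of "c *\<^sub>R (1, 0)" "(0, 1)"] D.neg[of "(c, 1)"] D.scaleR[of c "(1, 0)"] by simp
      also have "D (0, 1) = - (coeff_matrix \<rho> c *v D (1, 0))"
        using eq by (simp add: eq_neg_iff_add_eq_0)
      finally have "riemann \<rho> c (D (- c, - 1)) = 0"
        using nz by (simp add: R.neg R.add R.diff R.scaleR riemann_coeff_matrix)
      then show "riemann \<rho> c (D (k *\<^sub>R (- c, - 1))) = 0 * k"
        unfolding D.scaleR R.scaleR by simp
    qed
    ultimately show "DERIV \<phi> s :> 0" by (simp only: has_field_derivative_def)
  qed (use t in auto)
  then show ?thesis by (simp add: \<phi>_def)
qed simp

text \<open>
  The integrated form of \<open>\<partial>w/\<partial>t = q\<close> passes to the limit at boundary points, because both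
  sides are continuous up to the boundary.
\<close>

lemma boundary_trace_has_derivative:
  fixes w q :: "real \<times> real \<Rightarrow> 'b::banach"
  assumes w: "continuous_on (closure I \<times> {t0..}) w" and q: "continuous_on (closure I \<times> {t0..}) q"
    and deriv: "\<And>x t. x \<in> I \<Longrightarrow> t \<ge> t0 \<Longrightarrow>
      ((\<lambda>s. w (x, s)) has_vector_derivative q (x, t)) (at t within {t0..})"
    and "a \<in> closure I" "t \<ge> t0"
  shows "((\<lambda>s. w (a, s)) has_vector_derivative q (a, t)) (at t within {t0..})"
proof -
  have cont: "continuous_on (closure I) (\<lambda>x. w (x, s))" if "s \<ge> t0" for s
    using that by (intro continuous_on_compose2[OF w]) (auto intro!: continuous_intros)
  have ftc: "w (a, s) = w (a, t0) + integral {t0..s} (\<lambda>\<tau>. q (a, \<tau>))" if "s \<ge> t0" for s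
  proof -
    have "continuous_on (closure I) (\<lambda>x. integral (cbox t0 s) (\<lambda>\<tau>. q (x, \<tau>)))"
      by (rule integral_continuous_on_param)
        (use q in \<open>auto simp: case_prod_beta intro: continuous_on_subset\<close>)
    then have "continuous_on (closure I)
        (\<lambda>x. w (x, s) - w (x, t0) - integral {t0..s} (\<lambda>\<tau>. q (x, \<tau>)))"
      using that by (intro continuous_on_diff cont) auto
    moreover have "w (x, s) - w (x, t0) - integral {t0..s} (\<lambda>\<tau>. q (x, \<tau>)) = 0" if "x \<in> I" for x
    proof -
      have "((\<lambda>\<tau>. q (x, \<tau>)) has_integral w (x, s) - w (x, t0)) {t0..s}"
        using \<open>s \<ge> t0\<close> that
        by (intro fundamental_theorem_of_calculus has_vector_derivative_within_subset[OF deriv]) auto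
      then show ?thesis by (simp add: integral_unique)
    qed
    ultimately have "w (a, s) - w (a, t0) - integral {t0..s} (\<lambda>\<tau>. q (a, \<tau>)) = 0"
      using \<open>a \<in> closure I\<close> by (rule continuous_constant_on_closure)
    then show ?thesis by (simp add: algebra_simps)
  qed
  have "continuous_on {t0..t+1} (\<lambda>\<tau>. q (a, \<tau>))"
    using assms by (intro continuous_on_compose2[OF q]) (auto intro!: continuous_intros)
  then have "((\<lambda>s. integral {t0..s} (\<lambda>\<tau>. q (a, \<tau>))) has_vector_derivative q (a, t))
      (at t within {t0..t+1})"
    by (rule integral_has_vector_derivative) (use \<open>t \<ge> t0\<close> in auto)
  then have "((\<lambda>s. w (a, t0) + integral {t0..s} (\<lambda>\<tau>. q (a, \<tau>))) has_vector_derivative 0 + q (a, t))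
      (at t within {t0..t+1})"
    by (intro has_vector_derivative_add has_vector_derivative_const)
  then have deriv': "((\<lambda>s. w (a, t0) + integral {t0..s} (\<lambda>\<tau>. q (a, \<tau>))) has_vector_derivative q (a, t))
      (at t within {t0..t+1})"
    by simp
  have "((\<lambda>s. w (a, s)) has_vector_derivative q (a, t)) (at t within {t0..t+1})"
  proof (rule has_vector_derivative_transform[OF _ _ deriv'])
    show "t \<in> {t0..t+1}" using \<open>t \<ge> t0\<close> by simp
    show "w (a, s) = w (a, t0) + integral {t0..s} (\<lambda>\<tau>. q (a, \<tau>))" if "s \<in> {t0..t+1}" for s
      using ftc[of s] that by simp
  qed
  also have "at t within {t0..t+1} = at t within {t0..}"
    using \<open>t \<ge> t0\<close> by (intro at_within_nhd[of t "{..<t+1}"]) auto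
  finally show ?thesis .
qed

lemma at_within_atLeast_neq_bot:
  fixes t t0 :: real
  assumes "t \<ge> t0"
  shows "at t within {t0..} \<noteq> bot"
proof -
  have "at_right t \<le> at t within {t0..}"
    using assms by (intro at_le) auto
  then show ?thesis
    by (metis bot_unique trivial_limit_at_right_real)
qed

lemma partial_derivatives:
  assumes "open I" "x \<in> I" "t \<ge> t0"
    and D: "(U has_derivative D) (at (x, t) within I \<times> {t0..})"
  shows "((\<lambda>y. U (y, t)) has_vector_derivative D (1, 0)) (at x)"
    and "((\<lambda>s. U (x, s)) has_vector_derivative D (0, 1)) (at t within {t0..})"
    and "partial_x U (x, t) = D (1, 0)"
    and "partial_t t0 U (x, t) = D (0, 1)"
proof -
  interpret D: bounded_linear D using D by (rule has_derivative_bounded_linear)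
  have "((\<lambda>y. (y, t)) has_derivative (\<lambda>k. (k, 0))) (at x within I)"
    by (auto intro!: derivative_eq_intros)
  moreover have "(U has_derivative D) (at (x, t) within (\<lambda>y. (y, t)) ` I)"
    using D by (rule has_derivative_subset) (use assms in auto)
  ultimately have "((\<lambda>y. U (y, t)) has_derivative (\<lambda>k. D (k, 0))) (at x within I)"
    by (rule has_derivative_in_compose)
  moreover have "(\<lambda>k. D (k, 0)) = (\<lambda>k. k *\<^sub>R D (1, 0))"
  proof
    fix k show "D (k, 0) = k *\<^sub>R D (1, 0)"
      unfolding D.scaleR[symmetric] by simp
  qed
  ultimately show 1: "((\<lambda>y. U (y, t)) has_vector_derivative D (1, 0)) (at x)"
    by (simp only: has_vector_derivative_def at_within_open[OF assms(2,1)])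
  have "((\<lambda>s. (x, s)) has_derivative (\<lambda>k. (0, k))) (at t within {t0..})"
    by (auto intro!: derivative_eq_intros)
  moreover have "(U has_derivative D) (at (x, t) within (\<lambda>s. (x, s)) ` {t0..})"
    using D by (rule has_derivative_subset) (use assms in auto)
  ultimately have "((\<lambda>s. U (x, s)) has_derivative (\<lambda>k. D (0, k))) (at t within {t0..})"
    by (rule has_derivative_in_compose)
  moreover have "(\<lambda>k. D (0, k)) = (\<lambda>k. k *\<^sub>R D (0, 1))"
  proof
    fix k show "D (0, k) = k *\<^sub>R D (0, 1)"
      unfolding D.scaleR[symmetric] by simp
  qed
  ultimately show 2: "((\<lambda>s. U (x, s)) has_vector_derivative D (0, 1)) (at t within {t0..})"
    by (simp only: has_vector_derivative_def)
  show "partial_x U (x, t) = D (1, 0)"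
    using vector_derivative_at[OF 1] by (simp add: partial_x_def)
  show "partial_t t0 U (x, t) = D (0, 1)"
    using vector_derivative_within[OF at_within_atLeast_neq_bot[OF \<open>t \<ge> t0\<close>] 2] by (simp add: partial_t_def)
qed

section \<open>One-sided limits at the interface\<close>

lemma trace_tendsto:
  assumes W: "continuous_on (closure I \<times> {t0..}) W" and eq: "\<And>z. z \<in> I \<times> {t0..} \<Longrightarrow> W z = w z"
    and "a \<in> closure I" "t \<ge> t0"
  shows "((\<lambda>x. w (x, t)) \<longlongrightarrow> W (a, t)) (at a within I)"
proof -
  have "continuous_on (closure I) (\<lambda>x. W (x, t))"
    using \<open>t \<ge> t0\<close> by (intro continuous_on_compose2[OF W]) (auto intro!: continuous_intros)
  then have "((\<lambda>x. W (x, t)) \<longlongrightarrow> W (a, t)) (at a within closure I)"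
    using \<open>a \<in> closure I\<close> by (simp add: continuous_on_def)
  then have "((\<lambda>x. W (x, t)) \<longlongrightarrow> W (a, t)) (at a within I)"
    by (rule tendsto_within_subset) (rule closure_subset)
  moreover have "\<forall>\<^sub>F x in at a within I. W (x, t) = w (x, t)"
    unfolding eventually_at_filter using eq \<open>t \<ge> t0\<close> by (intro always_eventually) auto
  ultimately show ?thesis by (rule Lim_transform_eventually)
qed

lemma boundary_initial_value:
  fixes W :: "real \<times> real \<Rightarrow> 'b::real_normed_vector"
  assumes W: "continuous_on (closure I \<times> {t0..}) W" and f: "continuous_on UNIV f"
    and eq: "\<And>x. x \<in> I \<Longrightarrow> W (x, t0) = f x" and "x \<in> closure I"
  shows "W (x, t0) = f x"
proof -
  have "continuous_on (closure I) (\<lambda>x. W (x, t0) - f x)"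
    by (intro continuous_on_diff continuous_on_compose2[OF W] continuous_on_subset[OF f])
      (auto intro!: continuous_intros)
  then have "W (x, t0) - f x = 0"
    by (rule continuous_constant_on_closure) (use assms in auto)
  then show ?thesis by simp
qed

lemma trace_left_eq:
  fixes W :: "real \<times> real \<Rightarrow> 'b::t2_space"
  assumes "continuous_on ({..\<alpha>} \<times> {t0..}) W" and "\<And>z. z \<in> {..<\<alpha>} \<times> {t0..} \<Longrightarrow> W z = w z"
    and "t \<ge> t0"
  shows "trace_left \<alpha> w t = W (\<alpha>, t)"
  unfolding trace_left_def
  using trace_tendsto[of "{..<\<alpha>}" t0 W w \<alpha> t] assms
  by (intro tendsto_Lim trivial_limit_at_left_real) auto

lemma trace_right_eq:
  fixes W :: "real \<times> real \<Rightarrow> 'b::t2_space"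
  assumes "continuous_on ({\<alpha>..} \<times> {t0..}) W" and "\<And>z. z \<in> {\<alpha><..} \<times> {t0..} \<Longrightarrow> W z = w z"
    and "t \<ge> t0"
  shows "trace_right \<alpha> w t = W (\<alpha>, t)"
  unfolding trace_right_def
  using trace_tendsto[of "{\<alpha><..}" t0 W w \<alpha> t] assms
  by (intro tendsto_Lim trivial_limit_at_right_real) auto

lemma partial_x_component:
  fixes V :: "real \<times> real \<Rightarrow> real^2"
  assumes "open I" "z \<in> I \<times> {t0..}" and "(V has_derivative D) (at z within I \<times> {t0..})"
  shows "partial_x (\<lambda>z. V z $ i) z = partial_x V z $ i"
proof -
  obtain x t where z: "z = (x, t)" "x \<in> I" "t \<ge> t0" using assms(2) by auto
  have "((\<lambda>z. V z $ i) has_derivative (\<lambda>h. D h $ i)) (at z within I \<times> {t0..})"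
    using assms(3) by (rule bounded_linear.has_derivative[OF bounded_linear_vec_nth])
  then show ?thesis
    using partial_derivatives(3)[OF \<open>open I\<close> z(2,3)] assms(3) unfolding z(1) by metis
qed

text \<open>
  A classical solution on one side, together with its continuous extension \<open>W\<close> and the extension
  \<open>X\<close> of its space derivative. The last conclusion is the equation at the interface, where
  the space derivative only exists as the limit \<open>X\<close>.
\<close>

lemma one_sided_solution:
  assumes "open I" and "Ck_on 1 (I \<times> {t0..}) V"
    and ext: "\<And>w. w \<in> {V, partial_x V, partial_t t0 V} \<Longrightarrow>
      extends_continuously (I \<times> {t0..}) (closure I \<times> {t0..}) w"
    and pde: "\<And>z. z \<in> I \<times> {t0..} \<Longrightarrow> partial_t t0 V z + coeff_matrix \<rho> c *v partial_x V z = 0"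
  obtains W X where "wave_solution I t0 \<rho> c W"
    and "\<And>z. z \<in> I \<times> {t0..} \<Longrightarrow> W z = V z"
    and "continuous_on (closure I \<times> {t0..}) X"
    and "\<And>z i. z \<in> I \<times> {t0..} \<Longrightarrow> partial_x (\<lambda>z. V z $ i) z = X z $ i"
    and "\<And>a t. a \<in> closure I \<Longrightarrow> t \<ge> t0 \<Longrightarrow>
      ((\<lambda>s. W (a, s)) has_vector_derivative - (coeff_matrix \<rho> c *v X (a, t))) (at t within {t0..})"
proof -
  obtain D where D: "\<And>z. z \<in> I \<times> {t0..} \<Longrightarrow> (V has_derivative D z) (at z within I \<times> {t0..})"
    using assms(2) by auto
  obtain W where W: "continuous_on (closure I \<times> {t0..}) W" "\<And>z. z \<in> I \<times> {t0..} \<Longrightarrow> W z = V z"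
    using ext[of V] by (auto simp: extends_continuously_def)
  obtain X where X: "continuous_on (closure I \<times> {t0..}) X"
    "\<And>z. z \<in> I \<times> {t0..} \<Longrightarrow> X z = partial_x V z"
    using ext[of "partial_x V"] by (auto simp: extends_continuously_def)
  have dW: "(W has_derivative D z) (at z within I \<times> {t0..})" if "z \<in> I \<times> {t0..}" for z
    using that W(2) by (intro has_derivative_transform[OF _ _ D[OF that]]) auto
  have D_x: "D z (1, 0) = X z" and D_t: "D z (0, 1) = - (coeff_matrix \<rho> c *v X z)"
    if zI: "z \<in> I \<times> {t0..}" for z
  proof -
    obtain x t where z: "z = (x, t)" "x \<in> I" "t \<ge> t0" using zI by auto
    note part = partial_derivatives(3,4)[OF \<open>open I\<close> z(2,3), of V "D z"]
    show "D z (1, 0) = X z" using part D[OF zI] X(2)[OF zI] z(1) by simp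
    show "D z (0, 1) = - (coeff_matrix \<rho> c *v X z)"
      using part D[OF zI] X(2)[OF zI] pde[OF zI] z(1) by (simp add: eq_neg_iff_add_eq_0)
  qed
  have sol: "wave_solution I t0 \<rho> c W"
    unfolding wave_solution_def using W(1) dW D_x D_t
    by (auto intro!: exI[of _ "D _"])
  have trace: "((\<lambda>s. W (a, s)) has_vector_derivative - (coeff_matrix \<rho> c *v X (a, t))) (at t within {t0..})"
    if "a \<in> closure I" "t \<ge> t0" for a t
  proof (rule boundary_trace_has_derivative[where q = "\<lambda>z. - (coeff_matrix \<rho> c *v X z)", OF W(1) _ _ that])
    show "continuous_on (closure I \<times> {t0..}) (\<lambda>z. - (coeff_matrix \<rho> c *v X z))"
      by (intro continuous_on_minus bounded_linear.continuous_on[OF matrix_vector_mul_bounded_linear] X(1))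
    fix x t assume xt: "x \<in> I" "t \<ge> t0"
    then show "((\<lambda>s. W (x, s)) has_vector_derivative - (coeff_matrix \<rho> c *v X (x, t))) (at t within {t0..})"
      using partial_derivatives(2)[OF \<open>open I\<close> xt dW] D_t[of "(x, t)"] by auto
  qed
  have comp: "partial_x (\<lambda>z. V z $ i) z = X z $ i" if "z \<in> I \<times> {t0..}" for z i
    using partial_x_component[OF \<open>open I\<close> that D[OF that]] X(2)[OF that] by simp
  show thesis by (rule that[OF sol W(2) X(1) comp trace])
qed

lemma partials_of_restriction:
  assumes "open I" and W: "\<And>z. (W has_derivative D z) (at z)"
    and eq: "\<And>z. z \<in> I \<times> {t0..} \<Longrightarrow> U z = W z" and zI: "z \<in> I \<times> {t0..}"
  shows "(U has_derivative D z) (at z within I \<times> {t0..})"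
    and "partial_x U z = D z (1, 0)" and "partial_t t0 U z = D z (0, 1)"
proof -
  obtain x t where z: "z = (x, t)" "x \<in> I" "t \<ge> t0" using zI by auto
  show deriv: "(U has_derivative D z) (at z within I \<times> {t0..})"
    using zI eq by (intro has_derivative_transform[OF _ _ has_derivative_at_withinI[OF W]]) auto
  then show "partial_x U z = D z (1, 0)" "partial_t t0 U z = D z (0, 1)"
    using partial_derivatives(3,4)[OF \<open>open I\<close> z(2,3), of U "D z"] z(1) by auto
qed

lemma extension_of_C1:
  assumes "open I" and W: "\<And>z. (W has_derivative D z) (at z)"
    and D: "\<And>h. continuous_on UNIV (\<lambda>z. D z h)"
    and eq: "\<And>z. z \<in> I \<times> {t0..} \<Longrightarrow> U z = W z"
    and "w \<in> {U, partial_x U, partial_t t0 U}"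
  shows "extends_continuously (I \<times> {t0..}) (T \<times> {t0..}) w"
proof -
  have "continuous_on UNIV W"
    using W by (auto intro!: has_derivative_continuous_on)
  then obtain F where "continuous_on UNIV F" "\<forall>z \<in> I \<times> {t0..}. F z = w z"
    using assms(5) D eq partials_of_restriction(2,3)[OF assms(1) W eq]
    by (elim insertE emptyE) metis+
  then show ?thesis
    unfolding extends_continuously_def by (blast intro: continuous_on_subset)
qed

section \<open>Waves generated by the fracture\<close>

lemma jump_condition_iff:
  fixes a b E X w K :: real
  assumes "K > 0" "w \<noteq> 0"
  shows "a = b + E / K * (1 / w) * X \<longleftrightarrow> E * X = K * w * (a - b)"
  using assms by (auto simp: field_simps)

lemma supp_zero: "x \<notin> supp f \<Longrightarrow> f x = 0"
  unfolding supp_def using closure_subset by force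

text \<open>
  The data of the problem, with a stress \<open>S\<close> that solves the interface equation on the whole
  time axis and vanishes up to \<open>t0\<close>.
\<close>

locale fracture_wave =
  fixes \<alpha> t0 \<rho>0 c0 \<rho>1 c1 K d :: real and U0 :: "real \<Rightarrow> real^2" and S :: "real \<Rightarrow> real"
  assumes pos: "\<rho>0 > 0" "c0 > 0" "\<rho>1 > 0" "c1 > 0" "K > 0" "d > 0"
    and U0_cont: "continuous_on UNIV U0"
    and U0_zero: "\<And>\<xi>. \<xi> \<ge> \<alpha> \<Longrightarrow> U0 \<xi> = 0"
    and S_zero: "\<And>t. t \<le> t0 \<Longrightarrow> S t = 0"
    and S_ode: "\<And>t. (S has_real_derivative stress_rate K d (1 / (\<rho>0 * c0) + 1 / (\<rho>1 * c1))
      (riemann \<rho>0 c0 (U0 (\<alpha> - c0 * (t - t0)))) (S t)) (at t)"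
    and S_less: "\<And>t. S t < K * d"
begin

text \<open>
  Amplitude that reaches the fracture at time \<open>t\<close> along the right-going characteristic.
\<close>

definition incident :: "real \<Rightarrow> real" where
  "incident t = riemann \<rho>0 c0 (U0 (\<alpha> - c0 * (t - t0)))"

definition right_going :: "real \<Rightarrow> real" where
  "right_going \<xi> = riemann \<rho>0 c0 (U0 \<xi>)"

text \<open>
  Amplitude sent back into the left medium at time \<open>t\<close>: from \<open>v = incident + S / Z\<close> and
  \<open>\<sigma> = S\<close> one gets \<open>v + \<sigma> / Z = incident + 2 S / Z\<close> with \<open>Z = \<rho>0 c0\<close>.
\<close>

definition outgoing :: "real \<Rightarrow> real" where
  "outgoing t = incident t + 2 * S t / (\<rho>0 * c0)"

text \<open>
  The initial left-going profile vanishes for \<open>\<xi> \<ge> \<alpha>\<close> and the outgoing one for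
  \<open>\<xi> \<le> \<alpha>\<close>, so the sum replaces a case distinction and is as smooth as its terms.
\<close>

definition left_going :: "real \<Rightarrow> real" where
  "left_going \<xi> = riemann \<rho>0 (- c0) (U0 \<xi>) + outgoing (t0 + (\<xi> - \<alpha>) / c0)"

text \<open>
  Without a left-going wave on the right, \<open>v = - \<sigma> / Z\<close> and the right-going invariant
  is \<open>v - \<sigma> / Z = - 2 \<sigma> / Z\<close>, with \<open>Z = \<rho>1 c1\<close>.
\<close>

definition transmitted :: "real \<Rightarrow> real" where
  "transmitted \<xi> = - 2 * S (t0 - (\<xi> - \<alpha>) / c1) / (\<rho>1 * c1)"

definition left_wave :: "real \<times> real \<Rightarrow> real^2" where
  "left_wave = wave \<rho>0 c0 t0 right_going left_going"

definition right_wave :: "real \<times> real \<Rightarrow> real^2" where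
  "right_wave = wave \<rho>1 c1 t0 transmitted (\<lambda>_. 0)"

definition solution :: "real \<times> real \<Rightarrow> real^2" where
  "solution z = (if fst z < \<alpha> then left_wave z else right_wave z)"

abbreviation "rate t s \<equiv> stress_rate K d (1 / (\<rho>0 * c0) + 1 / (\<rho>1 * c1)) (incident t) s"

lemma nonzero: "\<rho>0 \<noteq> 0" "c0 \<noteq> 0" "\<rho>1 \<noteq> 0" "c1 \<noteq> 0" "K \<noteq> 0" "d \<noteq> 0"
  using pos by auto

lemma riemann_zero: "riemann \<rho> c 0 = 0"
  by (simp add: riemann_def)

lemma incident_zero: "t \<le> t0 \<Longrightarrow> incident t = 0"
  using pos by (simp add: incident_def U0_zero riemann_zero mult_nonneg_nonpos)

lemma outgoing_zero: "t \<le> t0 \<Longrightarrow> outgoing t = 0"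
  by (simp add: outgoing_def incident_zero S_zero)

lemma incident_continuous: "continuous_on X incident"
  unfolding incident_def
  by (intro bounded_linear.continuous_on[OF bounded_linear_riemann] continuous_on_compose2[OF U0_cont])
    (auto intro!: continuous_intros)

text \<open>
  At times \<open>t \<ge> t0\<close> the interface only sees the part \<open>\<xi> \<ge> \<alpha>\<close> of the initial left-going profile,
  which is zero.
\<close>

lemma left_wave_at_interface:
  assumes "t \<ge> t0"
  shows "left_wave (\<alpha>, t) $ 1 = incident t + S t / (\<rho>0 * c0)" and "left_wave (\<alpha>, t) $ 2 = S t"
proof -
  have "\<alpha> + c0 * (t - t0) \<ge> \<alpha>" using assms pos by simp
  then have "left_going (\<alpha> + c0 * (t - t0)) = outgoing t"
    using pos by (simp add: left_going_def U0_zero riemann_zero)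
  moreover have "right_going (\<alpha> - c0 * (t - t0)) = incident t"
    by (simp add: right_going_def incident_def)
  ultimately have "left_wave (\<alpha>, t) = incident t *\<^sub>R eigenmode \<rho>0 c0 + outgoing t *\<^sub>R eigenmode \<rho>0 (- c0)"
    by (simp add: left_wave_def wave_def)
  then show "left_wave (\<alpha>, t) $ 1 = incident t + S t / (\<rho>0 * c0)" "left_wave (\<alpha>, t) $ 2 = S t"
    using nonzero by (simp_all add: eigenmode_def outgoing_def field_simps)
qed

lemma right_wave_at_interface:
  "right_wave (\<alpha>, t) $ 1 = - S t / (\<rho>1 * c1)" "right_wave (\<alpha>, t) $ 2 = S t"
  using nonzero by (simp_all add: right_wave_def wave_def eigenmode_def transmitted_def)

lemma solution_initial: "solution (x, t0) = U0 x"
proof (cases "x < \<alpha>")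
  case True
  then have "(x - \<alpha>) / c0 \<le> 0" using pos by (simp add: divide_le_0_iff)
  then have "outgoing (t0 + (x - \<alpha>) / c0) = 0" by (intro outgoing_zero) simp
  then show ?thesis
    using True riemann_decomposition[of \<rho>0 c0 "U0 x"] nonzero
    by (simp add: solution_def left_wave_def wave_def right_going_def left_going_def)
next
  case False
  then have "(x - \<alpha>) / c1 \<ge> 0" using pos by simp
  then show ?thesis
    using False by (simp add: solution_def right_wave_def wave_def transmitted_def S_zero U0_zero)
qed

text \<open>
  For these traces the hyperbolic jump law, solved for
  \<open>\<rho>0 c0\<^sup>2 \<partial>v/\<partial>x\<close>, is the interface equation. The branch condition
  makes the denominator nonzero.
\<close>

lemma jump_iff_ode:
  assumes "s < K * d"
  shows "- s / (\<rho>1 * c1) = (incident t + s / (\<rho>0 * c0))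
           + \<rho>0 * c0\<^sup>2 / K * (1 / (1 - s / (K * d))\<^sup>2) * X
     \<longleftrightarrow> \<rho>0 * c0\<^sup>2 * X = rate t s"
proof -
  have "s / (K * d) < 1" using assms pos by simp
  then have "1 - s / (K * d) \<noteq> 0" by linarith
  then have "(1 - s / (K * d))\<^sup>2 \<noteq> 0" by (rule power_not_zero)
  note iff = jump_condition_iff[OF pos(5) this]
  have "- s / (\<rho>1 * c1) - (incident t + s / (\<rho>0 * c0))
      = - incident t - (1 / (\<rho>0 * c0) + 1 / (\<rho>1 * c1)) * s"
    by (simp add: distrib_right)
  then have rate: "rate t s = K * (1 - s / (K * d))\<^sup>2 * (- s / (\<rho>1 * c1) - (incident t + s / (\<rho>0 * c0)))"
    by (simp only: stress_rate_def)
  show ?thesis unfolding rate by (rule iff)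
qed

section \<open>Uniqueness\<close>

lemma left_right_going:
  assumes W: "wave_solution {..<\<alpha>} t0 \<rho>0 c0 W"
    and init: "\<And>x. x \<le> \<alpha> \<Longrightarrow> W (x, t0) = U0 x" and "x \<le> \<alpha>" "t \<ge> t0"
  shows "riemann \<rho>0 c0 (W (x, t)) = right_going (x - c0 * (t - t0))"
proof (cases "t = t0")
  case True
  then show ?thesis using init \<open>x \<le> \<alpha>\<close> by (simp add: right_going_def)
next
  case False
  then have "t - t0 > 0" using \<open>t \<ge> t0\<close> by simp
  then have shift: "c0 * (t - t0) > 0" using pos(2) by (rule mult_pos_pos[rotated])
  have "riemann \<rho>0 c0 (W (x, t)) = riemann \<rho>0 c0 (W (x - c0 * (t - t0), t - (t - t0)))"
    by (rule riemann_constant_on_characteristic[OF W])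
      (use assms shift nonzero in auto)
  also have "\<dots> = right_going (x - c0 * (t - t0))"
    using init[of "x - c0 * (t - t0)"] shift \<open>x \<le> \<alpha>\<close> by (simp add: right_going_def)
  finally show ?thesis .
qed

text \<open>
  The backward characteristic goes to the right. Either it meets the initial line first, where the
  outgoing amplitude is still zero, or the interface, where the initial profile vanishes.
\<close>

lemma left_left_going:
  assumes W: "wave_solution {..<\<alpha>} t0 \<rho>0 c0 W"
    and init: "\<And>x. x \<le> \<alpha> \<Longrightarrow> W (x, t0) = U0 x"
    and S: "\<And>t. t \<ge> t0 \<Longrightarrow> W (\<alpha>, t) $ 2 = S t" and x: "x < \<alpha>" and t: "t \<ge> t0"
  shows "riemann \<rho>0 (- c0) (W (x, t)) = left_going (x + c0 * (t - t0))"
proof -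
  have W': "wave_solution {..<\<alpha>} t0 \<rho>0 (- c0) W" using W by (simp add: wave_solution_uminus)
  show ?thesis
  proof (cases "x + c0 * (t - t0) \<le> \<alpha>")
    case True
    have "riemann \<rho>0 (- c0) (W (x, t)) = riemann \<rho>0 (- c0) (W (x - (- c0) * (t - t0), t - (t - t0)))"
      by (rule riemann_constant_on_characteristic[OF W']) (use True x t nonzero in auto)
    also have "\<dots> = riemann \<rho>0 (- c0) (U0 (x + c0 * (t - t0)))"
      using init[OF True] by simp
    also have "outgoing (t0 + (x + c0 * (t - t0) - \<alpha>) / c0) = 0"
      using True pos(2) by (intro outgoing_zero) (simp add: divide_le_0_iff)
    then have "riemann \<rho>0 (- c0) (U0 (x + c0 * (t - t0))) = left_going (x + c0 * (t - t0))"
      by (simp add: left_going_def)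
    finally show ?thesis .
  next
    case False
    define h where "h = (\<alpha> - x) / c0"
    have "c0 * h = \<alpha> - x" using nonzero by (simp add: h_def)
    moreover have "h \<ge> 0" using x pos by (simp add: h_def)
    moreover have "t - h \<ge> t0" using False pos(2) by (simp add: h_def field_simps)
    ultimately have h: "h \<ge> 0" "x - (- c0) * h = \<alpha>" "t - h \<ge> t0" by auto
    have "riemann \<rho>0 (- c0) (W (x, t)) = riemann \<rho>0 (- c0) (W (x - (- c0) * h, t - h))"
      by (rule riemann_constant_on_characteristic[OF W'])
        (use h(1,3) x nonzero in \<open>auto simp: h(2)[simplified]\<close>)
    also have "\<dots> = riemann \<rho>0 c0 (W (\<alpha>, t - h)) + 2 * W (\<alpha>, t - h) $ 2 / (\<rho>0 * c0)"
      unfolding h(2) by (simp add: riemann_def)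
    also have "\<dots> = outgoing (t - h)"
      using left_right_going[OF W init order_refl h(3)] S[OF h(3)]
      by (simp add: outgoing_def incident_def right_going_def)
    also have "t - h = t0 + (x + c0 * (t - t0) - \<alpha>) / c0"
      using nonzero by (simp add: h_def field_simps)
    also have "outgoing \<dots> = left_going (x + c0 * (t - t0))"
      using False by (simp add: left_going_def U0_zero riemann_zero)
    finally show ?thesis .
  qed
qed

lemma right_left_going:
  assumes W: "wave_solution {\<alpha><..} t0 \<rho>1 c1 W"
    and init: "\<And>x. x \<ge> \<alpha> \<Longrightarrow> W (x, t0) = 0" and "x \<ge> \<alpha>" "t \<ge> t0"
  shows "riemann \<rho>1 (- c1) (W (x, t)) = 0"
proof (cases "t = t0")
  case True
  then show ?thesis using init \<open>x \<ge> \<alpha>\<close> by (simp add: riemann_zero)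
next
  case False
  have W': "wave_solution {\<alpha><..} t0 \<rho>1 (- c1) W" using W by (simp add: wave_solution_uminus)
  have "t - t0 > 0" using \<open>t \<ge> t0\<close> False by simp
  then have shift: "c1 * (t - t0) > 0" using pos(4) by (rule mult_pos_pos[rotated])
  have "riemann \<rho>1 (- c1) (W (x, t)) = riemann \<rho>1 (- c1) (W (x - (- c1) * (t - t0), t - (t - t0)))"
    by (rule riemann_constant_on_characteristic[OF W']) (use assms shift nonzero in auto)
  also have "\<dots> = 0"
    using init[of "x + c1 * (t - t0)"] shift \<open>x \<ge> \<alpha>\<close> by (simp add: riemann_zero)
  finally show ?thesis .
qed

text \<open>
  As for the left-going wave on the other side, a backward characteristic ends on the initial line
  or on the interface; the stress is zero up to \<open>t0\<close>, which covers the first case.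
\<close>

lemma right_right_going:
  assumes W: "wave_solution {\<alpha><..} t0 \<rho>1 c1 W"
    and init: "\<And>x. x \<ge> \<alpha> \<Longrightarrow> W (x, t0) = 0"
    and S: "\<And>t. t \<ge> t0 \<Longrightarrow> W (\<alpha>, t) $ 2 = S t" and x: "x > \<alpha>" and t: "t \<ge> t0"
  shows "riemann \<rho>1 c1 (W (x, t)) = transmitted (x - c1 * (t - t0))"
proof (cases "x - c1 * (t - t0) \<ge> \<alpha>")
  case True
  have "riemann \<rho>1 c1 (W (x, t)) = riemann \<rho>1 c1 (W (x - c1 * (t - t0), t - (t - t0)))"
    by (rule riemann_constant_on_characteristic[OF W]) (use True x t nonzero in auto)
  also have "\<dots> = 0"
    using init[OF True] by (simp add: riemann_zero)
  also have "S (t0 - (x - c1 * (t - t0) - \<alpha>) / c1) = 0"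
    using True pos(4) by (intro S_zero) simp
  then have "0 = transmitted (x - c1 * (t - t0))"
    by (simp add: transmitted_def)
  finally show ?thesis .
next
  case False
  define h where "h = (x - \<alpha>) / c1"
  have "c1 * h = x - \<alpha>" using nonzero by (simp add: h_def)
  moreover have "h \<ge> 0" using x pos by (simp add: h_def)
  moreover have "t - h \<ge> t0" using False pos(4) by (simp add: h_def field_simps)
  ultimately have h: "h \<ge> 0" "x - c1 * h = \<alpha>" "t - h \<ge> t0" by auto
  have "riemann \<rho>1 c1 (W (x, t)) = riemann \<rho>1 c1 (W (x - c1 * h, t - h))"
    by (rule riemann_constant_on_characteristic[OF W]) (use h x nonzero in auto)
  also have "\<dots> = riemann \<rho>1 (- c1) (W (\<alpha>, t - h)) - 2 * W (\<alpha>, t - h) $ 2 / (\<rho>1 * c1)"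
    unfolding h(2) by (simp add: riemann_def)
  also have "\<dots> = - 2 * S (t - h) / (\<rho>1 * c1)"
    using right_left_going[OF W init order_refl h(3)] S[OF h(3)] by simp
  also have "t - h = t0 - (x - c1 * (t - t0) - \<alpha>) / c1"
    using nonzero by (simp add: h_def field_simps)
  finally show ?thesis by (simp add: transmitted_def)
qed

text \<open>
  The traces of any solution satisfy the interface equation: its Riemann invariants arriving at the
  fracture are prescribed, and the space derivative in the jump law is the time derivative of the
  stress trace. So the stress trace is \<open>S\<close>, and \<open>S\<close> determines the outgoing waves.
\<close>

lemma solution_unique:
  assumes V: "global_solution \<alpha> t0 \<rho>0 c0 \<rho>1 c1 K d U0 V" and z: "x \<noteq> \<alpha>" "t \<ge> t0"
  shows "V (x, t) = solution (x, t)"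
proof -
  note V' = V[unfolded global_solution_def Let_def]
  have reg: "classical_regular \<alpha> t0 V"
    and branch: "\<And>t. t \<ge> t0 \<Longrightarrow> trace_left \<alpha> (\<lambda>z. V z $ 2) t < K * d"
    and pde: "\<And>x t. x \<noteq> \<alpha> \<Longrightarrow> t \<ge> t0 \<Longrightarrow> partial_t t0 V (x, t)
      + coeff_matrix (piecewise_const \<alpha> \<rho>0 \<rho>1 x) (piecewise_const \<alpha> c0 c1 x) *v partial_x V (x, t) = 0"
    and jump: "\<And>t. t \<ge> t0 \<Longrightarrow> trace_right \<alpha> (\<lambda>z. V z $ 1) t = trace_left \<alpha> (\<lambda>z. V z $ 1) t
       + \<rho>0 * c0\<^sup>2 / K * (1 / (1 - trace_left \<alpha> (\<lambda>z. V z $ 2) t / (K * d))\<^sup>2)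
         * trace_left \<alpha> (partial_x (\<lambda>z. V z $ 1)) t"
    and stress: "\<And>t. t \<ge> t0 \<Longrightarrow> trace_right \<alpha> (\<lambda>z. V z $ 2) t = trace_left \<alpha> (\<lambda>z. V z $ 2) t"
    and init: "\<And>x. V (x, t0) = U0 x"
    using V' by blast+
  have ext: "extends_continuously ({..<\<alpha>} \<times> {t0..}) ({..\<alpha>} \<times> {t0..}) w"
    "extends_continuously ({\<alpha><..} \<times> {t0..}) ({\<alpha>..} \<times> {t0..}) w"
    if "w \<in> {V, partial_x V, partial_t t0 V}" for w
    using reg that unfolding classical_regular_def by blast+
  have pde_left: "partial_t t0 V z + coeff_matrix \<rho>0 c0 *v partial_x V z = 0"
    if "z \<in> {..<\<alpha>} \<times> {t0..}" for z
    using that pde[of "fst z" "snd z"] by (cases z) (auto simp: piecewise_const_def)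
  have pde_right: "partial_t t0 V z + coeff_matrix \<rho>1 c1 *v partial_x V z = 0"
    if "z \<in> {\<alpha><..} \<times> {t0..}" for z
    using that pde[of "fst z" "snd z"] by (cases z) (auto simp: piecewise_const_def)
  have C1: "Ck_on 1 ({..<\<alpha>} \<times> {t0..}) V" "Ck_on 1 ({\<alpha><..} \<times> {t0..}) V"
    using reg by (simp_all only: classical_regular_def)
  obtain W X where W: "wave_solution {..<\<alpha>} t0 \<rho>0 c0 W"
    and WV: "\<And>z. z \<in> {..<\<alpha>} \<times> {t0..} \<Longrightarrow> W z = V z"
    and X: "continuous_on ({..\<alpha>} \<times> {t0..}) X"
    and XV: "\<And>z i. z \<in> {..<\<alpha>} \<times> {t0..} \<Longrightarrow> partial_x (\<lambda>z. V z $ i) z = X z $ i"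
    and W_t: "\<And>t. t \<ge> t0 \<Longrightarrow> ((\<lambda>s. W (\<alpha>, s)) has_vector_derivative
        - (coeff_matrix \<rho>0 c0 *v X (\<alpha>, t))) (at t within {t0..})"
    by (rule one_sided_solution[OF open_lessThan C1(1) _ pde_left]) (use ext in auto)
  obtain Y where Y: "wave_solution {\<alpha><..} t0 \<rho>1 c1 Y"
    and YV: "\<And>z. z \<in> {\<alpha><..} \<times> {t0..} \<Longrightarrow> Y z = V z"
    by (rule one_sided_solution[OF open_greaterThan C1(2) _ pde_right]) (use ext in auto)
  have W_cont: "continuous_on ({..\<alpha>} \<times> {t0..}) W" and Y_cont: "continuous_on ({\<alpha>..} \<times> {t0..}) Y"
    using W Y by (auto simp: wave_solution_def)
  have traces: "trace_left \<alpha> (\<lambda>z. V z $ i) t = W (\<alpha>, t) $ i"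
      "trace_right \<alpha> (\<lambda>z. V z $ i) t = Y (\<alpha>, t) $ i"
      "trace_left \<alpha> (partial_x (\<lambda>z. V z $ i)) t = X (\<alpha>, t) $ i" if "t \<ge> t0" for i t
    using that W_cont Y_cont X WV YV XV
    by (auto intro!: trace_left_eq trace_right_eq continuous_intros)
  have W_init: "W (x, t0) = U0 x" if "x \<le> \<alpha>" for x
  proof (rule boundary_initial_value[of "{..<\<alpha>}" t0 W U0 x])
    show "W (y, t0) = U0 y" if "y \<in> {..<\<alpha>}" for y
      using WV[of "(y, t0)"] init[of y] that by simp
  qed (use that W_cont U0_cont in auto)
  have Y_init: "Y (x, t0) = 0" if "x \<ge> \<alpha>" for x
  proof (rule boundary_initial_value[of "{\<alpha><..}" t0 Y "\<lambda>_. 0" x])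
    show "Y (y, t0) = 0" if "y \<in> {\<alpha><..}" for y
      using YV[of "(y, t0)"] init[of y] U0_zero[of y] that by simp
  qed (use that Y_cont in auto)
  have W_S: "W (\<alpha>, t) $ 2 = S t" if "t \<ge> t0" for t
  proof (rule stress_ode_unique[OF incident_continuous _ _ _ that])
    fix t assume t: "t \<ge> t0"
    have "((\<lambda>s. W (\<alpha>, s) $ 2) has_vector_derivative (- (coeff_matrix \<rho>0 c0 *v X (\<alpha>, t))) $ 2) (at t within {t0..})"
      by (rule bounded_linear.has_vector_derivative[OF bounded_linear_vec_nth W_t[OF t]])
    moreover have "(- (coeff_matrix \<rho>0 c0 *v X (\<alpha>, t))) $ 2 = \<rho>0 * c0\<^sup>2 * X (\<alpha>, t) $ 1"
      by (simp add: coeff_matrix_mult)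
    moreover have "\<rho>0 * c0\<^sup>2 * X (\<alpha>, t) $ 1 = rate t (W (\<alpha>, t) $ 2)"
    proof -
      have "riemann \<rho>0 c0 (W (\<alpha>, t)) = incident t"
        using left_right_going[OF W W_init order_refl t] by (simp add: incident_def right_going_def)
      then have 1: "W (\<alpha>, t) $ 1 = incident t + W (\<alpha>, t) $ 2 / (\<rho>0 * c0)"
        by (simp add: riemann_def)
      have "riemann \<rho>1 (- c1) (Y (\<alpha>, t)) = 0"
        using right_left_going[OF Y Y_init order_refl t] .
      then have 2: "Y (\<alpha>, t) $ 1 = - W (\<alpha>, t) $ 2 / (\<rho>1 * c1)"
        using stress[OF t] traces[OF t] by (simp add: riemann_def)
      show ?thesis
        using jump[OF t] branch[OF t] jump_iff_ode[of "W (\<alpha>, t) $ 2" t "X (\<alpha>, t) $ 1"]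
        unfolding traces[OF t] 1 2 by blast
    qed
    ultimately show "((\<lambda>s. W (\<alpha>, s) $ 2) has_real_derivative rate t (W (\<alpha>, t) $ 2)) (at t within {t0..})"
      by (simp add: has_real_derivative_iff_has_vector_derivative)
    show "(S has_real_derivative rate t (S t)) (at t within {t0..})"
      using S_ode[of t] unfolding incident_def by (rule has_field_derivative_at_within)
  next
    have "W (\<alpha>, t0) = 0" using W_init[of \<alpha>] U0_zero[of \<alpha>] by simp
    then show "W (\<alpha>, t0) $ 2 = S t0" by (simp add: S_zero)
  qed
  have Y_S: "Y (\<alpha>, t) $ 2 = S t" if "t \<ge> t0" for t
    using W_S[OF that] stress[OF that] traces[OF that] by simp
  show ?thesis
  proof (cases "x < \<alpha>")
    case True
    then show ?thesis
      using riemann_decomposition[of \<rho>0 c0 "W (x, t)"] nonzero WV[of "(x, t)"] z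
        left_right_going[OF W W_init, of x t] left_left_going[OF W W_init W_S True z(2)]
      by (simp add: solution_def left_wave_def wave_def)
  next
    case False
    with z have "x > \<alpha>" by simp
    then show ?thesis
      using riemann_decomposition[of \<rho>1 c1 "Y (x, t)"] nonzero YV[of "(x, t)"] z
        right_left_going[OF Y Y_init, of x t] right_right_going[OF Y Y_init Y_S \<open>x > \<alpha>\<close> z(2)] \<open>x > \<alpha>\<close>
      by (simp add: solution_def right_wave_def wave_def)
  qed
qed

section \<open>Existence\<close>

text \<open>
  All profiles are affine reparametrisations of the data and of \<open>S\<close>, which inherits the smoothness of
  the incident amplitude.
\<close>

lemma amplitudes_Ck:
  assumes "Ck_on p UNIV U0"
  shows "Ck_on p UNIV right_going" and "Ck_on p UNIV left_going" and "Ck_on p UNIV transmitted"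
proof -
  have amplitude: "Ck_on p UNIV (\<lambda>\<xi>. riemann \<rho> c (U0 \<xi>))" for \<rho> c
    using assms by (rule Ck_on_bounded_linear[OF bounded_linear_riemann])
  then show right: "Ck_on p UNIV right_going" by (simp add: right_going_def[abs_def])
  have affine: "Ck_on p UNIV (\<lambda>\<xi>. q (a * \<xi> + b))" if "Ck_on p UNIV q" for q :: "real \<Rightarrow> real" and a b
    using bounded_linear_mult_right that by (rule Ck_on_compose_affine)
  have "(\<lambda>t. right_going (- c0 * t + (\<alpha> + c0 * t0))) = incident"
    by (simp add: fun_eq_iff incident_def right_going_def algebra_simps)
  with affine[OF right, of "- c0" "\<alpha> + c0 * t0"] have inc: "Ck_on p UNIV incident" by simp
  have S: "Ck_on p UNIV S"
    by (rule stress_ode_Ck[OF S_ode[folded incident_def] inc])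
  have "Ck_on p UNIV (\<lambda>t. incident t + 2 / (\<rho>0 * c0) * S t)"
    by (intro Ck_on_add Ck_on_mult Ck_on_const inc S)
  moreover have "(\<lambda>t. incident t + 2 / (\<rho>0 * c0) * S t) = outgoing"
    by (simp add: fun_eq_iff outgoing_def)
  ultimately have out: "Ck_on p UNIV outgoing" by simp
  have "(\<lambda>\<xi>. riemann \<rho>0 (- c0) (U0 \<xi>) + outgoing (1 / c0 * \<xi> + (t0 - \<alpha> / c0))) = left_going"
    by (simp add: fun_eq_iff left_going_def algebra_simps diff_divide_distrib)
  with Ck_on_add[OF amplitude affine[OF out, of "1 / c0" "t0 - \<alpha> / c0"], of \<rho>0 "- c0"]
  show "Ck_on p UNIV left_going" by simp
  have "Ck_on p UNIV (\<lambda>\<xi>. (- 2 / (\<rho>1 * c1)) * S ((- 1 / c1) * \<xi> + (t0 + \<alpha> / c1)))"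
    by (intro Ck_on_mult Ck_on_const affine S)
  moreover have "(\<lambda>\<xi>. (- 2 / (\<rho>1 * c1)) * S ((- 1 / c1) * \<xi> + (t0 + \<alpha> / c1))) = transmitted"
    by (simp add: fun_eq_iff transmitted_def algebra_simps diff_divide_distrib)
  ultimately show "Ck_on p UNIV transmitted" by simp
qed

lemma waves_Ck:
  assumes "Ck_on p UNIV U0"
  shows "Ck_on p X left_wave" and "Ck_on p X right_wave"
  using amplitudes_Ck[OF assms]
  by (auto simp: left_wave_def right_wave_def intro!: Ck_on_wave Ck_on_const)

lemma waves_derivative:
  assumes "Ck_on p UNIV U0" "p \<ge> 1"
  obtains D E where "\<And>z. (left_wave has_derivative D z) (at z)"
    and "\<And>h. continuous_on UNIV (\<lambda>z. D z h)"
    and "\<And>z. D z (0, 1) + coeff_matrix \<rho>0 c0 *v D z (1, 0) = 0"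
    and "\<And>z. (right_wave has_derivative E z) (at z)"
    and "\<And>h. continuous_on UNIV (\<lambda>z. E z h)"
    and "\<And>z. E z (0, 1) + coeff_matrix \<rho>1 c1 *v E z (1, 0) = 0"
proof -
  note amplitude = amplitudes_Ck[OF assms(1), THEN Ck_on_real_derivative, OF assms(2)]
  have "Ck_on 1 UNIV left_wave" "Ck_on 1 UNIV right_wave"
    using waves_Ck[OF assms(1)] assms(2) Ck_on_le by blast+
  then obtain D E where D: "\<forall>z. (left_wave has_derivative D z) (at z)" "\<forall>h. continuous_on UNIV (\<lambda>z. D z h)"
    and E: "\<forall>z. (right_wave has_derivative E z) (at z)" "\<forall>h. continuous_on UNIV (\<lambda>z. E z h)"
    by auto
  have "D z (0, 1) + coeff_matrix \<rho>0 c0 *v D z (1, 0) = 0" for z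
    using wave_satisfies_system[OF amplitude(1,2) nonzero(1), of c0 t0 z UNIV] D(1)
    by (metis has_derivative_unique left_wave_def)
  moreover have "E z (0, 1) + coeff_matrix \<rho>1 c1 *v E z (1, 0) = 0" for z
    using wave_satisfies_system[OF amplitude(3) DERIV_const nonzero(3), of c1 t0 0 z UNIV] E(1)
    by (metis has_derivative_unique right_wave_def)
  ultimately show thesis using that D E by blast
qed

lemma solution_Ck:
  assumes "Ck_on p UNIV U0"
  shows "Ck_on p ({..<\<alpha>} \<times> {t0..}) solution" and "Ck_on p ({\<alpha><..} \<times> {t0..}) solution"
    and "Ck_on p ((UNIV - {\<alpha>}) \<times> {t0..}) solution"
proof -
  show left: "Ck_on p ({..<\<alpha>} \<times> {t0..}) solution"
    by (rule Ck_on_cong[OF _ waves_Ck(1)[OF assms]]) (auto simp: solution_def)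
  show right: "Ck_on p ({\<alpha><..} \<times> {t0..}) solution"
    by (rule Ck_on_cong[OF _ waves_Ck(2)[OF assms]]) (auto simp: solution_def)
  have "Ck_on p ({..<\<alpha>} \<times> {t0..} \<union> {\<alpha><..} \<times> {t0..}) solution"
    by (rule Ck_on_union_separated[of "{..<\<alpha>} \<times> UNIV" "{\<alpha><..} \<times> UNIV", OF _ _ _ _ _ left right])
      (auto intro!: open_Times)
  moreover have "{..<\<alpha>} \<times> {t0..} \<union> {\<alpha><..} \<times> {t0..} = (UNIV - {\<alpha>}) \<times> {t0..}" by auto
  ultimately show "Ck_on p ((UNIV - {\<alpha>}) \<times> {t0..}) solution" by simp
qed

text \<open>
  Both waves are smooth solutions on the whole plane, so the one-sided limits are values of the
  waves at \<open>x = \<alpha>\<close>. There the equation converts \<open>\<partial>v/\<partial>x\<close> into \<open>S'\<close>, and the jump law is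
  the equation for \<open>S\<close>.
\<close>

lemma solution_is_global_solution:
  assumes "Ck_on p UNIV U0" "p \<ge> 1"
  shows "global_solution \<alpha> t0 \<rho>0 c0 \<rho>1 c1 K d U0 solution"
proof -
  obtain D E where D: "\<And>z. (left_wave has_derivative D z) (at z)"
      "\<And>h. continuous_on UNIV (\<lambda>z. D z h)"
    and D_pde: "\<And>z. D z (0, 1) + coeff_matrix \<rho>0 c0 *v D z (1, 0) = 0"
    and E: "\<And>z. (right_wave has_derivative E z) (at z)"
      "\<And>h. continuous_on UNIV (\<lambda>z. E z h)"
    and E_pde: "\<And>z. E z (0, 1) + coeff_matrix \<rho>1 c1 *v E z (1, 0) = 0"
    using waves_derivative[OF assms] by blast
  have left: "solution z = left_wave z" if "z \<in> {..<\<alpha>} \<times> {t0..}" for z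
    using that by (auto simp: solution_def)
  have right: "solution z = right_wave z" if "z \<in> {\<alpha><..} \<times> {t0..}" for z
    using that by (auto simp: solution_def)
  have left_partials: "(solution has_derivative D z) (at z within {..<\<alpha>} \<times> {t0..})"
      "partial_x solution z = D z (1, 0)" "partial_t t0 solution z = D z (0, 1)"
    if "z \<in> {..<\<alpha>} \<times> {t0..}" for z
    by - (rule partials_of_restriction[OF open_lessThan D(1) left that]; assumption)+
  have right_partials: "(solution has_derivative E z) (at z within {\<alpha><..} \<times> {t0..})"
      "partial_x solution z = E z (1, 0)" "partial_t t0 solution z = E z (0, 1)"
    if "z \<in> {\<alpha><..} \<times> {t0..}" for z
    by - (rule partials_of_restriction[OF open_greaterThan E(1) right that]; assumption)+
  have cont: "continuous_on X left_wave" "continuous_on X right_wave" for X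
    using waves_Ck[OF assms(1)] Ck_on_continuous_on by blast+
  have "Ck_on 1 ({..<\<alpha>} \<times> {t0..}) solution" "Ck_on 1 ({\<alpha><..} \<times> {t0..}) solution"
    using solution_Ck(1,2)[OF assms(1)] assms(2) Ck_on_le by blast+
  then have reg: "classical_regular \<alpha> t0 solution"
    using extension_of_C1[OF open_lessThan D left] extension_of_C1[OF open_greaterThan E right]
    unfolding classical_regular_def by blast
  have pde: "partial_t t0 solution (x, t)
      + coeff_matrix (piecewise_const \<alpha> \<rho>0 \<rho>1 x) (piecewise_const \<alpha> c0 c1 x) *v partial_x solution (x, t) = 0"
    if "x \<noteq> \<alpha>" "t \<ge> t0" for x t
    using that left_partials(2,3)[of "(x, t)"] right_partials(2,3)[of "(x, t)"]
      D_pde[of "(x, t)"] E_pde[of "(x, t)"]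
    by (cases "x < \<alpha>") (auto simp: piecewise_const_def)
  have traces: "trace_left \<alpha> (\<lambda>z. solution z $ i) t = left_wave (\<alpha>, t) $ i"
      "trace_right \<alpha> (\<lambda>z. solution z $ i) t = right_wave (\<alpha>, t) $ i" if "t \<ge> t0" for i t
    using that left right
    by (intro trace_left_eq[where W = "\<lambda>z. left_wave z $ i"]
        trace_right_eq[where W = "\<lambda>z. right_wave z $ i"] continuous_intros cont; simp)+
  have trace_v_x: "trace_left \<alpha> (partial_x (\<lambda>z. solution z $ 1)) t = D (\<alpha>, t) (1, 0) $ 1"
    if "t \<ge> t0" for t
  proof (rule trace_left_eq[OF _ _ that])
    show "continuous_on ({..\<alpha>} \<times> {t0..}) (\<lambda>z. D z (1, 0) $ 1)"
      by (intro continuous_intros continuous_on_subset[OF D(2)]) auto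
    show "D z (1, 0) $ 1 = partial_x (\<lambda>z. solution z $ 1) z" if "z \<in> {..<\<alpha>} \<times> {t0..}" for z
      using partial_x_component[OF open_lessThan that left_partials(1)[OF that]]
        left_partials(2)[OF that] by simp
  qed
  have v_x: "\<rho>0 * c0\<^sup>2 * D (\<alpha>, t) (1, 0) $ 1 = rate t (S t)" if t: "t \<ge> t0" for t
  proof -
    have "((\<lambda>s. left_wave (\<alpha>, s)) has_vector_derivative D (\<alpha>, t) (0, 1)) (at t within {t0..})"
      by (rule partial_derivatives(2)[OF open_UNIV UNIV_I t has_derivative_at_withinI[OF D(1)]])
    from bounded_linear.has_vector_derivative[OF bounded_linear_vec_nth this, of 2]
    have "((\<lambda>s. left_wave (\<alpha>, s) $ 2) has_real_derivative D (\<alpha>, t) (0, 1) $ 2) (at t within {t0..})"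
      by (simp add: has_real_derivative_iff_has_vector_derivative)
    moreover have "((\<lambda>s. left_wave (\<alpha>, s) $ 2) has_real_derivative rate t (S t)) (at t within {t0..})"
      by (rule has_field_derivative_transform_within[OF
            has_field_derivative_at_within[OF S_ode[folded incident_def]], where d = 1])
        (use t left_wave_at_interface in auto)
    ultimately have "D (\<alpha>, t) (0, 1) $ 2 = rate t (S t)"
      using vector_derivative_unique_within[OF at_within_atLeast_neq_bot[OF t]]
      by (metis has_real_derivative_iff_has_vector_derivative)
    moreover have "D (\<alpha>, t) (0, 1) = - (coeff_matrix \<rho>0 c0 *v D (\<alpha>, t) (1, 0))"
      using D_pde by (simp add: eq_neg_iff_add_eq_0)
    ultimately show ?thesis by (simp add: coeff_matrix_mult)
  qed
  have jump: "trace_right \<alpha> (\<lambda>z. solution z $ 1) t = trace_left \<alpha> (\<lambda>z. solution z $ 1) t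
       + \<rho>0 * c0\<^sup>2 / K * (1 / (1 - trace_left \<alpha> (\<lambda>z. solution z $ 2) t / (K * d))\<^sup>2)
         * trace_left \<alpha> (partial_x (\<lambda>z. solution z $ 1)) t" if "t \<ge> t0" for t
    unfolding traces[OF that] trace_v_x[OF that] left_wave_at_interface[OF that] right_wave_at_interface
    using v_x[OF that] by (rule iffD2[OF jump_iff_ode[OF S_less]])
  show ?thesis
    unfolding global_solution_def Let_def
    using reg pde jump traces left_wave_at_interface right_wave_at_interface S_less solution_initial
    by auto
qed

end

theorem theorem1:
  fixes \<alpha> t0 \<rho>0 c0 \<rho>1 c1 K d :: real
    and p :: nat
    and U0 :: "real \<Rightarrow> real^2"
  assumes "\<rho>0 > 0" and "c0 > 0" and "\<rho>1 > 0" and "c1 > 0" and "K > 0" and "d > 0"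
    and "p \<ge> 1"
    and "Ck_on p UNIV U0" and "compact (supp U0)" and "supp U0 \<subseteq> {..<\<alpha>}"
  shows "\<exists>U. global_solution \<alpha> t0 \<rho>0 c0 \<rho>1 c1 K d U0 U \<and>
             Ck_on p ((UNIV - {\<alpha>}) \<times> {t0..}) U \<and>
             (\<forall>V. global_solution \<alpha> t0 \<rho>0 c0 \<rho>1 c1 K d U0 V \<longrightarrow>
                  (\<forall>z \<in> (UNIV - {\<alpha>}) \<times> {t0..}. V z = U z))"
proof -
  let ?\<beta> = "1 / (\<rho>0 * c0) + 1 / (\<rho>1 * c1)"
  define f where "f t = riemann \<rho>0 c0 (U0 (\<alpha> - c0 * (t - t0)))" for t
  have U0_cont: "continuous_on X U0" for X
    using Ck_on_continuous_on[OF assms(8)] by (rule continuous_on_subset) simp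
  have U0_zero: "U0 \<xi> = 0" if "\<xi> \<ge> \<alpha>" for \<xi>
    using assms(10) that by (intro supp_zero) auto
  have riemann_cont: "continuous_on X (\<lambda>\<xi>. riemann \<rho>0 c0 (U0 \<xi>))" for X
    using U0_cont by (rule bounded_linear.continuous_on[OF bounded_linear_riemann])
  have f_cont: "continuous_on UNIV f"
    unfolding f_def
    by (rule continuous_on_compose2[OF riemann_cont[of UNIV]]) (auto intro!: continuous_intros)
  have "bounded ((\<lambda>\<xi>. riemann \<rho>0 c0 (U0 \<xi>)) ` supp U0)"
    using assms(9) by (intro compact_imp_bounded compact_continuous_image riemann_cont)
  then obtain M where M: "\<And>\<xi>. \<xi> \<in> supp U0 \<Longrightarrow> \<bar>riemann \<rho>0 c0 (U0 \<xi>)\<bar> \<le> M"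
    by (auto simp: bounded_iff)
  have f_bound: "\<bar>f t\<bar> \<le> max M 0" for t
    using M[of "\<alpha> - c0 * (t - t0)"] supp_zero[of "\<alpha> - c0 * (t - t0)" U0]
    by (cases "\<alpha> - c0 * (t - t0) \<in> supp U0") (auto simp: f_def riemann_def)
  have f_zero: "f t = 0" if "t \<le> t0" for t
    using that assms(2) by (simp add: f_def U0_zero riemann_def mult_nonneg_nonpos)
  have "?\<beta> > 0" using assms by (simp add: add_pos_pos)
  then obtain S where S: "\<And>t. t \<le> t0 \<Longrightarrow> S t = 0"
      "\<And>t. (S has_real_derivative stress_rate K d ?\<beta> (f t) (S t)) (at t)"
      "\<And>t. S t < K * d"
    by (rule stress_ode_solution[OF assms(5,6) _ f_cont f_bound f_zero]) auto
  interpret fracture_wave \<alpha> t0 \<rho>0 c0 \<rho>1 c1 K d U0 S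
    using assms U0_cont U0_zero S unfolding f_def by unfold_locales auto
  show ?thesis
    using solution_is_global_solution[OF assms(8,7)] solution_Ck(3)[OF assms(8)] solution_unique
    by blast
qed

end
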